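(* Let $f\in C_d^2(\mathbb{R}\setminus\{0\})$. Let $D\in\mathcal{G}(\mathbb{R})$ be an arbitrary $\delta$-modelling generalized function as described in the context, and let $F\in\mathcal{G}(\mathbb{R})$ be the generalized model of $f$ built from $D$, with $F(\varphi_\varepsilon,x)=F_\sigma(x)=(f*D_\sigma)(x)$, $\sigma=\varepsilon s(\varphi)$. Then the product $F\cdot D'$ in $\mathcal{G}(\mathbb{R})$ is associated with a distribution, namely $$F(x)\cdot D'(x)\ \approx\ -(h_0+m_1)\,\delta+m_0\,\delta',$$ where $h_0=f(0_+)-f(0_-)$, $m_0=\tfrac12\big(f(0_-)+f(0_+)\big)$ and $m_1=\tfrac12\big(f'(0_-)+f'(0_+)\big)$.
   Context: Test functions: $\mathcal{D}(\mathbb{R})$ is the space of smooth compactly supported functions on $\mathbb{R}$. For $q\in\mathbb{N}_0$, $A_q(\mathbb{R})=\{\varphi\in\mathcal{D}(\mathbb{R}):\int x^j\varphi(x)\,dx=\delta_{0j},\ j=0,\dots,q\}$, with $\delta_{0j}$ the Kronecker symbol. For $\varphi\in A_0(\mathbb{R})$ and $\varepsilon>0$ put $\varphi_\varepsilon(x)=\varepsilon^{-1}\varphi(\varepsilon^{-1}x)$ and $s(\varphi)=\sup\{|x|:\varphi(x)\neq0\}>0$; then $s(\varphi_\varepsilon)=\varepsilon s(\varphi)$, denoted $\sigma$. Colombeau algebra: $\mathcal{E}[\mathbb{R}]$ is the algebra of functions $F(\varphi,x):A_0(\mathbb{R})\times\mathbb{R}\to\mathbb{C}$ that are smooth in $x$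 for each fixed $\varphi$. $\mathcal{G}(\mathbb{R})=\mathcal{E}_M[\mathbb{R}]/\mathcal{I}[\mathbb{R}]$, where $\mathcal{E}_M[\mathbb{R}]$ consists of those $F$ such that for each compact $K\subset\mathbb{R}$ and $p\in\mathbb{N}_0$ there is $q\in\mathbb{N}$ with $\sup_{x\in K}|\partial_x^pF(\varphi_\varepsilon,x)|=O(\varepsilon^{-q})$ as $\varepsilon\to0_+$ for each $\varphi\in A_q(\mathbb{R})$; and $\mathcal{I}[\mathbb{R}]$ consists of those $F$ such that for each compact $K$ and $p\in\mathbb{N}_0$ there is $q\in\mathbb{N}$ with $\sup_{x\in K}|\partial_x^pF(\varphi_\varepsilon,x)|=O(\varepsilon^{r-q})$ as $\varepsilon\to 0_+$ for every $r\ge q$ and $\varphi\in A_r(\mathbb{R})$. Products and derivatives are taken on representatives. Association: $G\in\mathcal{G}(\mathbb{R})$ is associated with a distribution $u$, $G\approx u$, if for some (equivalently any) representative and each $\psi\in\mathcal{D}(\mathbb{R})$ there is $q\in\mathbb{N}_0$ such that for every $\varphi\in A_q(\mathbb{R})$, $\lim_{\varepsilon\to0_+}\int_{\mathbb{R}}G(\varphi_\varepsilon,x)\psi(x)\,dx=\langle u,\psi\rangle$. The $\delta$-modelling function $D$: $D(s,x)$, $s>0$, $x\in\mathbb{R}$, is any function such that for each real $s>0$: $D(s,\cdot)\in\mathcal{D}(\mathbb{R})$, $D(s,-x)=D(s,x)$, and $\frac1s\int_{\mathbb{R}}D^2(s,x)\,dx=\int_{\mathbb{R}}D(s,x)\,dx=1$.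 Put $D_\sigma(x)=\frac1\sigma D\!\left(\sigma,\frac x\sigma\right)$. The generalized function $D\in\mathcal{G}(\mathbb{R})$ is the one with representative $\varphi\mapsto D_{s(\varphi)}$, so its value at $\varphi_\varepsilon$ is $D_\sigma$ with $\sigma=\varepsilon s(\varphi)$; $D'$ is its derivative in $x$, with value $D_\sigma'(x)=\partial_xD_\sigma(x)$ at $\varphi_\varepsilon$. Function class: $C_d^k(\mathbb{R}\setminus\{0\})$ is the class of $k$-times differentiable functions $f$ on $\mathbb{R}\setminus\{0\}$ such that for each $0\le i\le k$ the one-sided limits $f^{(i)}(0_+)$ and $f^{(i)}(0_-)$ exist (finite), possibly different. Such $f$ is regarded as a locally integrable function on $\mathbb{R}$, $*$ denotes convolution, and the generalized model $F$ of $f$ has the representative $\varphi\mapsto f*D_{s(\varphi)}$. $\delta$ is the Dirac distribution at $0$ and $\delta'$ its derivative.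
   Formalization: D is additionally assumed to have, for all small s, the support of D(s,·) in one fixed interval and ∫|D(s,x)|²dx bounded; without such a condition the claim fails, e.g. for f=1 and D(s,x)=s g(sx) with g an even test function, ∫g=∫g²=1. *)

theory Defs
  imports "HOL-Analysis.Analysis" "HOL-Library.Landau_Symbols"
begin

section \<open>Test functions and distributions\<close>

text \<open>
  All function spaces are complex valued. For the family \<open>D\<close> below this is essential: a real family
  with \<open>\<integral>D(s,x)\<^sup>2 dx = s\<close> and \<open>\<integral>D(s,x) dx = 1\<close> cannot have supports that stay bounded as
  \<open>s \<rightarrow> 0\<close>, by the Cauchy-Schwarz inequality.
\<close>

definition nderiv :: "nat \<Rightarrow> (real \<Rightarrow> complex) \<Rightarrow> real \<Rightarrow> complex" where
  "nderiv p = ((\<lambda>f x. vector_derivative f (at x)) ^^ p)"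

definition smooth :: "(real \<Rightarrow> complex) \<Rightarrow> bool" where
  "smooth f \<longleftrightarrow> (\<forall>p x. nderiv p f differentiable at x)"

definition test_functions :: "(real \<Rightarrow> complex) set" where
  "test_functions = {\<phi>. smooth \<phi> \<and> compact (closure {x. \<phi> x \<noteq> 0})}"

definition distribution :: "((real \<Rightarrow> complex) \<Rightarrow> complex) \<Rightarrow> bool" where
  "distribution u \<longleftrightarrow>
     (\<forall>\<phi>\<in>test_functions. \<forall>\<psi>\<in>test_functions. \<forall>a b.
        u (\<lambda>x. a * \<phi> x + b * \<psi> x) = a * u \<phi> + b * u \<psi>) \<and>
     (\<forall>K. compact K \<longrightarrow> (\<exists>C N. \<forall>\<psi>\<in>test_functions. {x. \<psi> x \<noteq> 0} \<subseteq> K \<longrightarrow>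
        norm (u \<psi>) \<le> C * (\<Sum>p\<le>N. SUP x. norm (nderiv p \<psi> x))))"

definition dirac :: "(real \<Rightarrow> complex) \<Rightarrow> complex" where
  "dirac \<psi> = \<psi> 0"

definition distr_deriv :: "((real \<Rightarrow> complex) \<Rightarrow> complex) \<Rightarrow> (real \<Rightarrow> complex) \<Rightarrow> complex" where
  "distr_deriv u \<psi> = - u (nderiv 1 \<psi>)"


section \<open>The Colombeau algebra on the real line\<close>

definition mollifiers :: "nat \<Rightarrow> (real \<Rightarrow> complex) set" where
  "mollifiers q = {\<phi> \<in> test_functions.
     \<forall>j\<le>q. (LINT x|lborel. of_real (x ^ j) * \<phi> x) = (if j = 0 then 1 else 0)}"

definition scaled :: "(real \<Rightarrow> complex) \<Rightarrow> real \<Rightarrow> real \<Rightarrow> complex" where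
  "scaled \<phi> \<epsilon> x = \<phi> (x / \<epsilon>) / of_real \<epsilon>"

definition supp_radius :: "(real \<Rightarrow> complex) \<Rightarrow> real" where
  "supp_radius \<phi> = Sup {\<bar>x\<bar> | x. \<phi> x \<noteq> 0}"

text \<open>
  Representatives are functions of \<open>\<phi>\<close> and \<open>x\<close>; their values for \<open>\<phi> \<notin> mollifiers 0\<close> are irrelevant, and
  functions that differ only there are identified in the quotient.
\<close>

type_synonym representative = "(real \<Rightarrow> complex) \<Rightarrow> real \<Rightarrow> complex"

definition basic_reps :: "representative set" where
  "basic_reps = {F. \<forall>\<phi>\<in>mollifiers 0. smooth (F \<phi>)}"

text \<open>The empty compact set is left out because \<open>Sup {}\<close> is unspecified on the reals.\<close>

definition moderate_reps :: "representative set" where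
  "moderate_reps = {F \<in> basic_reps. \<forall>K p. compact K \<and> K \<noteq> {} \<longrightarrow>
     (\<exists>q\<ge>1. \<forall>\<phi>\<in>mollifiers q.
        (\<lambda>\<epsilon>. SUP x\<in>K. norm (nderiv p (F (scaled \<phi> \<epsilon>)) x)) \<in> O[at_right 0](\<lambda>\<epsilon>. 1 / \<epsilon> ^ q))}"

definition null_reps :: "representative set" where
  "null_reps = {F \<in> basic_reps. \<forall>K p. compact K \<and> K \<noteq> {} \<longrightarrow>
     (\<exists>q\<ge>1. \<forall>r\<ge>q. \<forall>\<phi>\<in>mollifiers r.
        (\<lambda>\<epsilon>. SUP x\<in>K. norm (nderiv p (F (scaled \<phi> \<epsilon>)) x)) \<in> O[at_right 0](\<lambda>\<epsilon>. \<epsilon> ^ (r - q)))}"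

definition colombeau_rel :: "(representative \<times> representative) set" where
  "colombeau_rel = {(F, G). F \<in> moderate_reps \<and> G \<in> moderate_reps \<and>
     (\<lambda>\<phi> x. F \<phi> x - G \<phi> x) \<in> null_reps}"

definition colombeau_algebra :: "representative set set" where
  "colombeau_algebra = moderate_reps // colombeau_rel"

definition gclass :: "representative \<Rightarrow> representative set" where
  "gclass F = colombeau_rel `` {F}"

definition gmult :: "representative set \<Rightarrow> representative set \<Rightarrow> representative set" where
  "gmult X Y = (\<Union>F\<in>X. \<Union>G\<in>Y. gclass (\<lambda>\<phi> x. F \<phi> x * G \<phi> x))"

definition gdiff :: "representative set \<Rightarrow> representative set" where
  "gdiff X = (\<Union>F\<in>X. gclass (\<lambda>\<phi>. nderiv 1 (F \<phi>)))"

definition associated :: "representative set \<Rightarrow> ((real \<Rightarrow> complex) \<Rightarrow> complex) \<Rightarrow> bool" where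
  "associated X u \<longleftrightarrow> X \<in> colombeau_algebra \<and> distribution u \<and>
     (\<exists>G\<in>X. \<forall>\<psi>\<in>test_functions. \<exists>q. \<forall>\<phi>\<in>mollifiers q.
        ((\<lambda>\<epsilon>. LINT x|lborel. G (scaled \<phi> \<epsilon>) x * \<psi> x) \<longlongrightarrow> u \<psi>) (at_right 0))"


section \<open>Models of singularities\<close>

definition delta_modelling :: "(real \<Rightarrow> real \<Rightarrow> complex) \<Rightarrow> bool" where
  "delta_modelling D \<longleftrightarrow> (\<forall>s>0. D s \<in> test_functions \<and> (\<forall>x. D s (- x) = D s x) \<and>
     (LINT x|lborel. (D s x)\<^sup>2) / of_real s = 1 \<and> (LINT x|lborel. D s x) = 1)"

text \<open>
  The algebraic conditions in \<open>delta_modelling\<close> do not localise the family at \<open>0\<close>. If \<open>g\<close> is an even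
  test function with \<open>\<integral>g = \<integral>g\<^sup>2 = 1\<close>, then \<open>D s x = s g(s x)\<close> satisfies them while
  \<open>D(\<sigma>, x/\<sigma>)/\<sigma> = g(x)\<close> does not depend on \<open>\<sigma>\<close>. The next condition says that, for small \<open>s\<close>, the
  profiles \<open>D s\<close> live in a fixed interval and are bounded in \<open>L\<^sup>2\<close>; it does not constrain \<open>D s\<close>
  for large \<open>s\<close>.
\<close>

definition bounded_profiles :: "(real \<Rightarrow> real \<Rightarrow> complex) \<Rightarrow> bool" where
  "bounded_profiles D \<longleftrightarrow> (\<exists>l M. \<forall>\<^sub>F s in at_right 0.
     {x. D s x \<noteq> 0} \<subseteq> {-l..l} \<and> (LINT x|lborel. (norm (D s x))\<^sup>2) \<le> M)"

definition dilated :: "(real \<Rightarrow> real \<Rightarrow> complex) \<Rightarrow> real \<Rightarrow> real \<Rightarrow> complex" where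
  "dilated D \<sigma> x = D \<sigma> (x / \<sigma>) / of_real \<sigma>"

definition delta_rep :: "(real \<Rightarrow> real \<Rightarrow> complex) \<Rightarrow> representative" where
  "delta_rep D \<phi> = dilated D (supp_radius \<phi>)"

definition convolution :: "(real \<Rightarrow> complex) \<Rightarrow> (real \<Rightarrow> complex) \<Rightarrow> real \<Rightarrow> complex" where
  "convolution f g x = (LINT y|lborel. f y * g (x - y))"

definition model_rep :: "(real \<Rightarrow> real \<Rightarrow> complex) \<Rightarrow> (real \<Rightarrow> complex) \<Rightarrow> representative" where
  "model_rep D f \<phi> = convolution f (dilated D (supp_radius \<phi>))"

text \<open>
  Differentiability is two-sided at every point other than \<open>0\<close>; the value of \<open>f\<close> at \<open>0\<close>, and that
  of \<open>nderiv i f\<close> there, plays no role.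
\<close>

definition Cd :: "nat \<Rightarrow> (real \<Rightarrow> complex) set" where
  "Cd k = {f. (\<forall>i<k. \<forall>x. x \<noteq> 0 \<longrightarrow> nderiv i f differentiable at x) \<and>
     (\<forall>i\<le>k. (\<exists>L. (nderiv i f \<longlongrightarrow> L) (at_right 0)) \<and> (\<exists>L. (nderiv i f \<longlongrightarrow> L) (at_left 0)))}"

end

theory Submission
  imports Defs
begin

text \<open>
  Write \<open>e = D\<^sub>\<sigma>\<close> and \<open>F = f * e\<close>. Integrating by parts, \<open>\<integral> F e' \<psi> = - \<integral> e F' \<psi> - \<integral> e F \<psi>'\<close>, and the jump of
  \<open>f\<close> gives \<open>F' = h0 e + f' * e\<close>. So three limits are needed: \<open>\<integral> e\<^sup>2 \<psi> \<rightarrow> \<psi>(0)\<close>, as \<open>\<integral> e\<^sup>2 = 1\<close>;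
  and \<open>\<integral> e (g * e) \<psi> \<rightarrow> (g(0-) + g(0+)) / 2 \<psi>(0)\<close> for \<open>g = f\<close> and \<open>g = f'\<close>, because near \<open>0\<close> the function \<open>g\<close>
  is its mean value plus a multiple of \<open>sgn\<close>, and \<open>e (sgn * e)\<close> is odd.
  Integrals of products with \<open>F\<close> compute the product in the algebra because \<open>null_reps\<close> is a
  differential ideal of \<open>moderate_reps\<close>.
\<close>

section \<open>Iterated derivatives and smooth functions\<close>

text \<open>The derivative is moved off \<open>e\<close> because nothing quantitative is known about
  \<open>e'\<close>: moderateness bounds it only by some unspecified power of 1/\<epsilon>. The
  function \<open>e\<close> itself is under control: \<open>bounded_profiles\<close> gives a support
  of length O(\<sigma>), a bounded L1 norm, and a squared L2 norm of order at most 1/\<sigma>. The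
  L1 bound suffices for the limits with \<open>g * e\<close>, since convolution with
  \<open>e\<close> keeps bounded functions bounded. The square is harder: the profiles are complex,
  so \<open>e\<^sup>2\<close> has integral 1 but is no positive kernel, and the integral of its
  modulus may blow up. In the limit, -h0 comes from the jump term in \<open>F'\<close>, -m1 from the
  convolution with \<open>f'\<close>, and the remaining term is -m0 times \<psi>'(0), which is m0
  times the value of \<delta>' at \<psi>. The mollifier enters only through \<sigma>, so the limits
  can be taken in \<sigma>.\<close>

lemma nderiv_0 [simp]: "nderiv 0 f = f"
  by (simp add: nderiv_def)

lemma nderiv_Suc: "nderiv (Suc p) f = (\<lambda>x. vector_derivative (nderiv p f) (at x))"
  by (simp add: nderiv_def)

lemma nderiv_nderiv: "nderiv p (nderiv q f) = nderiv (p + q) f"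
  by (simp add: nderiv_def funpow_add)

lemma nderiv_1: "(f has_vector_derivative g) (at x) \<Longrightarrow> nderiv 1 f x = g"
  by (simp add: nderiv_Suc vector_derivative_at)

lemma smooth_has_vector_derivative:
  "smooth f \<Longrightarrow> (nderiv p f has_vector_derivative nderiv (Suc p) f x) (at x)"
  by (simp add: smooth_def nderiv_Suc flip: vector_derivative_works)

lemma smooth_nderiv: "smooth f \<Longrightarrow> smooth (nderiv p f)"
  by (simp add: smooth_def nderiv_nderiv)

lemma smooth_continuous_on: "smooth f \<Longrightarrow> continuous_on A (nderiv p f)"
  by (meson smooth_def differentiable_imp_continuous_on differentiable_on_def
      differentiable_at_withinI)

lemma smooth_borel: "smooth f \<Longrightarrow> nderiv p f \<in> borel_measurable borel"
  by (simp add: borel_measurable_continuous_onI smooth_continuous_on)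

text \<open>A candidate sequence in which each member differentiates to the next settles smoothness
  and all iterated derivatives at once; sums, dilations, constants and convolutions are treated this
  way.\<close>

lemma smoothI_nderiv:
  assumes "\<And>p x. (G p has_vector_derivative G (Suc p) x) (at x)"
  shows "smooth (G 0)" "nderiv p (G 0) = G p"
proof -
  have *: "nderiv p (G 0) = G p" for p
    by (induction p) (simp_all add: nderiv_Suc vector_derivative_at[OF assms])
  then show "nderiv p (G 0) = G p" .
  show "smooth (G 0)"
    unfolding smooth_def * using assms differentiableI_vector by blast
qed

lemma
  assumes "smooth f" "smooth g"
  shows smooth_add: "smooth (\<lambda>x. f x + g x)"
    and nderiv_add: "nderiv p (\<lambda>x. f x + g x) = (\<lambda>x. nderiv p f x + nderiv p g x)"
  using smoothI_nderiv[of "\<lambda>p x. nderiv p f x + nderiv p g x"]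
  by (simp_all add: assms smooth_has_vector_derivative has_vector_derivative_add)

lemma smooth_affine:
  assumes "smooth f"
  shows "smooth (\<lambda>x. c * f (a * x))"
proof -
  \<comment> \<open>The p-fold chain rule in closed form is the candidate sequence for
    \<open>smoothI_nderiv\<close>.\<close>
  have *: "((\<lambda>x. c * of_real a ^ p * nderiv p f (a * x)) has_vector_derivative
      c * of_real a ^ Suc p * nderiv (Suc p) f (a * x)) (at x)" for p x
  proof -
    have "((\<lambda>x. a * x) has_vector_derivative a) (at x)"
      by (auto intro!: derivative_eq_intros)
    from vector_diff_chain_at[OF this smooth_has_vector_derivative[OF assms]]
    have "((\<lambda>x. nderiv p f (a * x)) has_vector_derivative a *\<^sub>R nderiv (Suc p) f (a * x)) (at x)"
      by (simp add: o_def)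
    then have "((\<lambda>x. (c * of_real a ^ p) * nderiv p f (a * x)) has_vector_derivative
        (c * of_real a ^ p) * (a *\<^sub>R nderiv (Suc p) f (a * x))) (at x)"
      by (rule has_vector_derivative_mult_right)
    then show ?thesis
      by (simp add: scaleR_conv_of_real mult_ac)
  qed
  show ?thesis
    using smoothI_nderiv(1)[of "\<lambda>p x. c * of_real a ^ p * nderiv p f (a * x)", OF *] by simp
qed

lemma nderiv_1_mult:
  assumes "f differentiable at x" "g differentiable at x"
  shows "nderiv 1 (\<lambda>x. f x * g x) x = f x * nderiv 1 g x + nderiv 1 f x * g x"
  using assms unfolding nderiv_Suc One_nat_def nderiv_0
  by (intro vector_derivative_at has_vector_derivative_mult) (simp_all flip: vector_derivative_works)

lemma smooth_mult:
  assumes "smooth f" "smooth g"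
  shows "smooth (\<lambda>x. f x * g x)"
proof -
  \<comment> \<open>The sums of products of smooth functions are closed under differentiation.\<close>
  define S where "S = {h. \<exists>(n::nat) u v. (\<forall>i<n. smooth (u i) \<and> smooth (v i)) \<and> h = (\<lambda>x. \<Sum>i<n. u i x * v i x)}"
  have step: "\<exists>h'\<in>S. \<forall>x. (h has_vector_derivative h' x) (at x)" if hS: "h \<in> S" for h
  proof -
    obtain n u v where uv: "\<And>i. i < n \<Longrightarrow> smooth (u i)" "\<And>i. i < n \<Longrightarrow> smooth (v i)"
      and h: "h = (\<lambda>x. \<Sum>i<(n::nat). u i x * v i x)"
      using hS unfolding S_def by auto
    \<comment> \<open>The product rule turns n products into 2n: even indices carry u v', odd
      indices u' v.\<close>
    define U where "U i = (if even i then u (i div 2) else nderiv 1 (u (i div 2)))" for i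
    define V where "V i = (if odd i then v (i div 2) else nderiv 1 (v (i div 2)))" for i
    have sum_eq: "(\<Sum>i<2*n. U i x * V i x) =
        (\<Sum>i<n. u i x * nderiv 1 (v i) x + nderiv 1 (u i) x * v i x)" for x
      by (induction n) (auto simp: U_def V_def)
    have "(\<lambda>x. \<Sum>i<2*n. U i x * V i x) \<in> S"
      unfolding S_def
      by (rule CollectI, rule exI[of _ "2*n"], rule exI[of _ U], rule exI[of _ V])
        (auto simp: U_def V_def uv smooth_nderiv)
    moreover have "(h has_vector_derivative (\<Sum>i<2*n. U i x * V i x)) (at x)" for x
      unfolding h sum_eq
      using smooth_has_vector_derivative[OF uv(1), of _ 0] smooth_has_vector_derivative[OF uv(2), of _ 0]
      by (auto intro!: has_vector_derivative_sum has_vector_derivative_mult)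
    ultimately show ?thesis
      by (intro bexI[of _ "\<lambda>x. \<Sum>i<2*n. U i x * V i x"]) auto
  qed
  have "nderiv p (\<lambda>x. f x * g x) \<in> S" for p
  proof (induction p)
    case 0
    show ?case
      using assms unfolding S_def
      by (intro CollectI exI[of _ 1] exI[of _ "\<lambda>_. f"] exI[of _ "\<lambda>_. g"]) simp
  next
    case (Suc p)
    then obtain h' where "h' \<in> S" and h': "\<And>x. (nderiv p (\<lambda>x. f x * g x) has_vector_derivative h' x) (at x)"
      using step by blast
    moreover have "nderiv (Suc p) (\<lambda>x. f x * g x) = h'"
      by (simp add: nderiv_Suc fun_eq_iff vector_derivative_at[OF h'])
    ultimately show ?case
      by simp
  qed
  then show ?thesis
    unfolding smooth_def using step differentiableI_vector by blast
qed


section \<open>Test functions and mollifiers\<close>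

lemma test_functions_iff:
  "\<phi> \<in> test_functions \<longleftrightarrow> smooth \<phi> \<and> (\<exists>R. {x. \<phi> x \<noteq> 0} \<subseteq> {-R..R})"
proof -
  have "bounded S \<longleftrightarrow> (\<exists>R. S \<subseteq> {-R..R})" for S :: "real set"
  proof
    assume "bounded S"
    then obtain R where "\<And>x. x \<in> S \<Longrightarrow> \<bar>x\<bar> \<le> R"
      by (auto simp: bounded_real)
    then show "\<exists>R. S \<subseteq> {-R..R}"
      by (intro exI[of _ R]) (auto simp: abs_le_iff minus_le_iff)
  qed (meson bounded_closed_interval bounded_subset)
  then show ?thesis
    by (simp add: test_functions_def compact_closure)
qed

lemma test_functions_smooth: "\<phi> \<in> test_functions \<Longrightarrow> smooth \<phi>"
  by (simp add: test_functions_def)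

lemma test_functions_support:
  assumes "\<phi> \<in> test_functions"
  obtains R where "R > 0" "{x. \<phi> x \<noteq> 0} \<subseteq> {-R..R}"
proof -
  from assms obtain R where "{x. \<phi> x \<noteq> 0} \<subseteq> {-R..R}"
    by (auto simp: test_functions_iff)
  then have "{x. \<phi> x \<noteq> 0} \<subseteq> {- max R 1..max R 1}"
    by (rule order_trans) auto
  then show ?thesis
    by (intro that[of "max R 1"]) auto
qed

lemma nderiv_support:
  assumes "smooth \<phi>" "{x. \<phi> x \<noteq> 0} \<subseteq> S" "closed S"
  shows "{x. nderiv p \<phi> x \<noteq> 0} \<subseteq> S"
proof (induction p)
  case (Suc p)
  have "nderiv (Suc p) \<phi> x = 0" if "x \<notin> S" for x
  proof -
    \<comment> \<open>Since \<open>S\<close> is closed, its complement is a neighbourhood of x on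
      which the p-th derivative is constantly 0.\<close>
    have "((\<lambda>_. 0) has_vector_derivative nderiv (Suc p) \<phi> x) (at x)"
      using smooth_has_vector_derivative[OF assms(1), of p x] _ _
      by (rule has_vector_derivative_transform_within_open[where S = "-S"])
        (use assms(3) that Suc in auto)
    then show ?thesis
      using vector_derivative_at has_vector_derivative_const by metis
  qed
  then show ?case
    by blast
qed (use assms in simp)

lemma nderiv_test_functions: "\<phi> \<in> test_functions \<Longrightarrow> nderiv p \<phi> \<in> test_functions"
  using nderiv_support[of \<phi> "{-R..R}" p for R] unfolding test_functions_iff
  by (meson closed_atLeastAtMost smooth_nderiv)

lemma test_functions_bounded:
  assumes "\<phi> \<in> test_functions"
  obtains B where "B > 0" "\<And>x. norm (\<phi> x) \<le> B"
proof -
  obtain R where R: "{x. \<phi> x \<noteq> 0} \<subseteq> {-R..R}"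
    using test_functions_support[OF assms] .
  have "continuous_on {-R..R} \<phi>"
    using smooth_continuous_on[OF test_functions_smooth[OF assms], of _ 0] by simp
  then have "bounded (\<phi> ` {-R..R})"
    by (intro compact_imp_bounded compact_continuous_image) auto
  then obtain B where "B > 0" "\<And>x. x \<in> {-R..R} \<Longrightarrow> norm (\<phi> x) \<le> B"
    by (auto simp: bounded_pos)
  moreover have "\<phi> x = 0" if "x \<notin> {-R..R}" for x
    using R that by blast
  ultimately have "norm (\<phi> x) \<le> B" for x
    by (cases "x \<in> {-R..R}") auto
  with \<open>B > 0\<close> show ?thesis
    by (rule that)
qed

lemma test_functions_borel [measurable]: "\<phi> \<in> test_functions \<Longrightarrow> \<phi> \<in> borel_measurable borel"
  using smooth_borel[of \<phi> 0] by (simp add: test_functions_smooth)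

lemma test_functions_mult:
  "\<phi> \<in> test_functions \<Longrightarrow> smooth \<psi> \<Longrightarrow> (\<lambda>x. \<phi> x * \<psi> x) \<in> test_functions"
  unfolding test_functions_iff
  by (auto intro!: smooth_mult)

lemma
  fixes h :: "real \<Rightarrow> complex"
  assumes h: "h \<in> borel_measurable borel" "{x. h x \<noteq> 0} \<subseteq> {-R..R}"
    and B: "\<And>x. x \<in> {-R..R} \<Longrightarrow> norm (h x) \<le> B"
  shows integrable_bounded_support: "integrable lborel h"
    and integral_bounded_support: "R \<ge> 0 \<Longrightarrow> norm (LINT x|lborel. h x) \<le> 2 * R * B"
proof -
  have le: "norm (h x) \<le> B * indicator {-R..R} x" for x
    using h(2) B by (auto simp: indicator_def)
  have int: "integrable lborel (\<lambda>x. B * indicator {-R..R} x :: real)"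
    by (intro integrable_mult_right integrable_real_indicator) (auto simp: emeasure_lborel_Icc_eq)
  show "integrable lborel h"
    by (rule Bochner_Integration.integrable_bound[OF int])
      (use h(1) order_trans[OF le abs_ge_self] in auto)
  then have "norm (LINT x|lborel. h x) \<le> (LINT x|lborel. B * indicator {-R..R} x)"
    by (intro Bochner_Integration.integral_norm_bound_integral int le)
  then show "norm (LINT x|lborel. h x) \<le> 2 * R * B" if "R \<ge> 0"
    using that by (simp add: mult_ac)
qed

lemma test_functions_integrable: "\<phi> \<in> test_functions \<Longrightarrow> integrable lborel \<phi>"
  by (meson integrable_bounded_support test_functions_bounded test_functions_borel
      test_functions_support)

lemma scaled_test_functions:
  assumes "\<phi> \<in> test_functions" "\<epsilon> > 0"
  shows "scaled \<phi> \<epsilon> \<in> test_functions"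
proof -
  obtain R where R: "{x. \<phi> x \<noteq> 0} \<subseteq> {-R..R}"
    using test_functions_support[OF assms(1)] .
  have "smooth (\<lambda>x. 1 / of_real \<epsilon> * \<phi> (1 / \<epsilon> * x))"
    using assms by (intro smooth_affine test_functions_smooth)
  moreover have "scaled \<phi> \<epsilon> = (\<lambda>x. 1 / of_real \<epsilon> * \<phi> (1 / \<epsilon> * x))"
    by (simp add: scaled_def fun_eq_iff)
  moreover have "{x. scaled \<phi> \<epsilon> x \<noteq> 0} \<subseteq> {-(\<epsilon> * R)..\<epsilon> * R}"
  proof
    fix x assume "x \<in> {x. scaled \<phi> \<epsilon> x \<noteq> 0}"
    then have "x / \<epsilon> \<in> {-R..R}"
      using R by (auto simp: scaled_def)
    then show "x \<in> {-(\<epsilon> * R)..\<epsilon> * R}"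
      using assms(2) by (simp add: field_simps)
  qed
  ultimately show ?thesis
    by (auto simp: test_functions_iff)
qed

lemma mollifiers_test_functions: "\<phi> \<in> mollifiers q \<Longrightarrow> \<phi> \<in> test_functions"
  by (simp add: mollifiers_def)

lemma mollifiers_antimono: "p \<le> q \<Longrightarrow> mollifiers q \<subseteq> mollifiers p"
  unfolding mollifiers_def by (blast intro: le_trans)

lemma scaled_mollifiers:
  assumes \<phi>: "\<phi> \<in> mollifiers q" and \<epsilon>: "\<epsilon> > 0"
  shows "scaled \<phi> \<epsilon> \<in> mollifiers q"
proof -
  \<comment> \<open>Dilation multiplies the j-th moment by \<epsilon>^j, which preserves both
    prescribed values: 1 for j = 0 and 0 for j > 0.\<close>
  have "(LINT x|lborel. of_real (x ^ j) * scaled \<phi> \<epsilon> x) =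
      of_real \<epsilon> ^ j * (LINT x|lborel. of_real (x ^ j) * \<phi> x)" for j
  proof -
    have "of_real ((0 + \<epsilon> * x) ^ j) * scaled \<phi> \<epsilon> (0 + \<epsilon> * x) =
        of_real \<epsilon> ^ j / of_real \<epsilon> * (of_real (x ^ j) * \<phi> x)" for x
      using \<epsilon> by (simp add: scaled_def power_mult_distrib)
    then show ?thesis
      using \<epsilon> lborel_integral_real_affine[of \<epsilon> "\<lambda>x. of_real (x ^ j) * scaled \<phi> \<epsilon> x" 0]
      by (simp add: scaleR_conv_of_real)
  qed
  with assms show ?thesis
    by (auto simp: mollifiers_def scaled_test_functions)
qed

lemma
  assumes \<phi>: "\<phi> \<in> mollifiers 0"
  shows supp_radius_pos: "supp_radius \<phi> > 0"
    and supp_radius_scaled: "\<epsilon> > 0 \<Longrightarrow> supp_radius (scaled \<phi> \<epsilon>) = \<epsilon> * supp_radius \<phi>"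
proof -
  \<comment> \<open>A function supported at the origin alone is zero almost everywhere and cannot
    have integral 1. The fact is stated for every \<phi> because it is applied to the scaled
    mollifier as well.\<close>
  have *: "\<exists>x. x \<noteq> 0 \<and> \<phi> x \<noteq> 0" if \<phi>: "\<phi> \<in> mollifiers 0" for \<phi>
  proof (rule ccontr)
    assume "\<nexists>x. x \<noteq> 0 \<and> \<phi> x \<noteq> 0"
    then have "AE x in lborel. \<phi> x = 0"
      using AE_lborel_singleton[of 0] by (auto elim!: eventually_mono)
    then have "(LINT x|lborel. \<phi> x) = 0"
      by (rule integral_eq_zero_AE)
    with \<phi> show False
      by (simp add: mollifiers_def)
  qed
  have bdd: "bdd_above {\<bar>x\<bar> |x. \<phi> x \<noteq> 0}" if \<phi>: "\<phi> \<in> mollifiers 0" for \<phi>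
  proof -
    obtain R where "{x. \<phi> x \<noteq> 0} \<subseteq> {-R..R}"
      using test_functions_support[OF mollifiers_test_functions[OF \<phi>]] .
    then show ?thesis
      by (intro bdd_aboveI[of _ R]) fastforce
  qed
  obtain x where "x \<noteq> 0" "\<phi> x \<noteq> 0"
    using *[OF \<phi>] by blast
  then show "supp_radius \<phi> > 0"
    unfolding supp_radius_def
    by (intro less_cSup_iff[THEN iffD2] bdd[OF \<phi>]) auto
  show "supp_radius (scaled \<phi> \<epsilon>) = \<epsilon> * supp_radius \<phi>" if \<epsilon>: "\<epsilon> > 0"
  proof (rule antisym)
    note \<phi>' = scaled_mollifiers[OF \<phi> \<epsilon>]
    show "supp_radius (scaled \<phi> \<epsilon>) \<le> \<epsilon> * supp_radius \<phi>"
      unfolding supp_radius_def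
    proof (rule cSup_least)
      fix r assume "r \<in> {\<bar>x\<bar> |x. scaled \<phi> \<epsilon> x \<noteq> 0}"
      then obtain x where "r = \<bar>x\<bar>" "\<phi> (x / \<epsilon>) \<noteq> 0"
        by (auto simp: scaled_def)
      then have "\<bar>x / \<epsilon>\<bar> \<le> Sup {\<bar>x\<bar> |x. \<phi> x \<noteq> 0}"
        by (intro cSup_upper bdd[OF \<phi>] CollectI exI[of _ "x / \<epsilon>"]) auto
      then show "r \<le> \<epsilon> * Sup {\<bar>x\<bar> |x. \<phi> x \<noteq> 0}"
        using \<epsilon> \<open>r = \<bar>x\<bar>\<close> by (simp add: field_simps)
    qed (use *[OF \<phi>'] in auto)
    have "supp_radius \<phi> \<le> supp_radius (scaled \<phi> \<epsilon>) / \<epsilon>"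
      unfolding supp_radius_def
    proof (rule cSup_least)
      fix r assume "r \<in> {\<bar>x\<bar> |x. \<phi> x \<noteq> 0}"
      then obtain x where "r = \<bar>x\<bar>" "\<phi> x \<noteq> 0"
        by auto
      then have "\<bar>\<epsilon> * x\<bar> \<le> Sup {\<bar>x\<bar> |x. scaled \<phi> \<epsilon> x \<noteq> 0}"
        using \<epsilon> by (intro cSup_upper bdd[OF \<phi>'] CollectI exI[of _ "\<epsilon> * x"]) (auto simp: scaled_def)
      then show "r \<le> Sup {\<bar>x\<bar> |x. scaled \<phi> \<epsilon> x \<noteq> 0} / \<epsilon>"
        using \<epsilon> \<open>r = \<bar>x\<bar>\<close> by (simp add: field_simps abs_mult)
    qed (use *[OF \<phi>] in auto)
    then show "\<epsilon> * supp_radius \<phi> \<le> supp_radius (scaled \<phi> \<epsilon>)"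
      using \<epsilon> by (simp add: field_simps)
  qed
qed


section \<open>Moderate and null representatives\<close>

text \<open>A pointwise bound on \<open>K\<close> with one constant replaces the Landau bound on a
  supremum, so that estimates can be added and multiplied without first checking that suprema
  exist.\<close>

definition deriv_bound ::
    "real set \<Rightarrow> nat \<Rightarrow> representative \<Rightarrow> (real \<Rightarrow> complex) \<Rightarrow> (real \<Rightarrow> real) \<Rightarrow> bool" where
  "deriv_bound K p F \<phi> w \<longleftrightarrow>
     (\<exists>c. \<forall>\<^sub>F \<epsilon> in at_right 0. \<forall>x\<in>K. norm (nderiv p (F (scaled \<phi> \<epsilon>)) x) \<le> c * w \<epsilon>)"

lemma eventually_at_right_0: "\<delta> > 0 \<Longrightarrow> \<forall>\<^sub>F \<epsilon> in at_right (0::real). 0 < \<epsilon> \<and> \<epsilon> < \<delta>"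
  unfolding eventually_at_right_field by auto

lemma eventually_basic_reps:
  assumes "F \<in> basic_reps" "\<phi> \<in> mollifiers q"
  shows "\<forall>\<^sub>F \<epsilon> in at_right 0. smooth (F (scaled \<phi> \<epsilon>))"
  using eventually_at_right_0[OF zero_less_one]
proof eventually_elim
  case (elim \<epsilon>)
  then have "scaled \<phi> \<epsilon> \<in> mollifiers 0"
    using assms(2) scaled_mollifiers mollifiers_antimono[of 0 q] by blast
  then show ?case
    using assms(1) by (simp add: basic_reps_def)
qed

text \<open>Continuous derivatives are bounded on a compact set, so the supremum is a genuine one,
  and \<open>K \<noteq> {}\<close> makes it nonnegative. Smoothness of
  \<open>F (scaled \<phi> \<epsilon>)\<close> is available for \<epsilon> > 0, hence the two
  conditions are compared eventually.\<close>

lemma deriv_bound_iff: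
  assumes F: "F \<in> basic_reps" "\<phi> \<in> mollifiers q" and K: "compact K" "K \<noteq> {}"
    and w: "\<And>\<epsilon>. \<epsilon> > 0 \<Longrightarrow> w \<epsilon> \<ge> 0"
  shows "(\<lambda>\<epsilon>. SUP x\<in>K. norm (nderiv p (F (scaled \<phi> \<epsilon>)) x)) \<in> O[at_right 0](w) \<longleftrightarrow>
    deriv_bound K p F \<phi> w"
proof -
  have eq: "norm (SUP x\<in>K. norm (nderiv p g x)) \<le> c \<longleftrightarrow> (\<forall>x\<in>K. norm (nderiv p g x) \<le> c)"
    if "smooth g" for g c
  proof -
    have "bounded (nderiv p g ` K)"
      using that K by (intro compact_imp_bounded compact_continuous_image smooth_continuous_on)
    then have bdd: "bdd_above ((\<lambda>x. norm (nderiv p g x)) ` K)"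
      by (auto simp: bounded_iff bdd_above_def)
    obtain x0 where "x0 \<in> K"
      using K by blast
    then have "0 \<le> (SUP x\<in>K. norm (nderiv p g x))"
      by (intro order_trans[OF norm_ge_zero cSUP_upper[OF _ bdd]])
    then show ?thesis
      using cSUP_le_iff[OF K(2) bdd] by simp
  qed
  have "deriv_bound K p F \<phi> w \<longleftrightarrow> (\<exists>c. \<forall>\<^sub>F \<epsilon> in at_right 0.
      norm (SUP x\<in>K. norm (nderiv p (F (scaled \<phi> \<epsilon>)) x)) \<le> c * norm (w \<epsilon>))"
    unfolding deriv_bound_def
  proof (intro arg_cong[of _ _ Ex] ext eventually_subst)
    fix c
    show "\<forall>\<^sub>F \<epsilon> in at_right 0. (\<forall>x\<in>K. norm (nderiv p (F (scaled \<phi> \<epsilon>)) x) \<le> c * w \<epsilon>) =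
        (norm (SUP x\<in>K. norm (nderiv p (F (scaled \<phi> \<epsilon>)) x)) \<le> c * norm (w \<epsilon>))"
      using eventually_basic_reps[OF F] eventually_at_right_0[OF zero_less_one]
      by eventually_elim (use eq w in auto)
  qed
  then show ?thesis
    by (auto intro: bigoI elim: landau_o.bigE)
qed

lemma deriv_bound_mono:
  assumes "deriv_bound K p F \<phi> v" "\<forall>\<^sub>F \<epsilon> in at_right 0. 0 \<le> v \<epsilon> \<and> v \<epsilon> \<le> w \<epsilon>"
  shows "deriv_bound K p F \<phi> w"
proof -
  obtain c where "\<forall>\<^sub>F \<epsilon> in at_right 0. \<forall>x\<in>K. norm (nderiv p (F (scaled \<phi> \<epsilon>)) x) \<le> c * v \<epsilon>"
    using assms(1) by (auto simp: deriv_bound_def)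
  \<comment> \<open>The constant \<open>c\<close> may be negative; its absolute value makes the
    bound monotone in the weight.\<close>
  with assms(2) have "\<forall>\<^sub>F \<epsilon> in at_right 0. \<forall>x\<in>K. norm (nderiv p (F (scaled \<phi> \<epsilon>)) x) \<le> \<bar>c\<bar> * w \<epsilon>"
  proof eventually_elim
    case (elim \<epsilon>)
    have "c * v \<epsilon> \<le> \<bar>c\<bar> * w \<epsilon>"
      using elim by (intro mult_mono) auto
    with elim show ?case
      by (auto intro: order_trans)
  qed
  then show ?thesis
    by (auto simp: deriv_bound_def)
qed

lemma deriv_bound_add:
  assumes "F \<in> basic_reps" "G \<in> basic_reps" "\<phi> \<in> mollifiers q"
    and "deriv_bound K p F \<phi> w" "deriv_bound K p G \<phi> w"
  shows "deriv_bound K p (\<lambda>\<phi> x. F \<phi> x + G \<phi> x) \<phi> w"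
proof -
  obtain c d where
      "\<forall>\<^sub>F \<epsilon> in at_right 0. \<forall>x\<in>K. norm (nderiv p (F (scaled \<phi> \<epsilon>)) x) \<le> c * w \<epsilon>"
      "\<forall>\<^sub>F \<epsilon> in at_right 0. \<forall>x\<in>K. norm (nderiv p (G (scaled \<phi> \<epsilon>)) x) \<le> d * w \<epsilon>"
    using assms(4,5) by (auto simp: deriv_bound_def)
  with eventually_basic_reps[OF assms(1,3)] eventually_basic_reps[OF assms(2,3)]
  have "\<forall>\<^sub>F \<epsilon> in at_right 0. \<forall>x\<in>K.
      norm (nderiv p (\<lambda>x. F (scaled \<phi> \<epsilon>) x + G (scaled \<phi> \<epsilon>) x) x) \<le> (c + d) * w \<epsilon>"
    by eventually_elim (auto simp: nderiv_add distrib_right intro!: norm_triangle_le add_mono)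
  then show ?thesis
    by (auto simp: deriv_bound_def)
qed

lemma basic_reps_add:
  "F \<in> basic_reps \<Longrightarrow> G \<in> basic_reps \<Longrightarrow> (\<lambda>\<phi> x. F \<phi> x + G \<phi> x) \<in> basic_reps"
  by (auto simp: basic_reps_def smooth_add)

lemma basic_reps_mult:
  "F \<in> basic_reps \<Longrightarrow> G \<in> basic_reps \<Longrightarrow> (\<lambda>\<phi> x. F \<phi> x * G \<phi> x) \<in> basic_reps"
  by (auto simp: basic_reps_def smooth_mult)

lemma basic_reps_nderiv: "F \<in> basic_reps \<Longrightarrow> (\<lambda>\<phi>. nderiv k (F \<phi>)) \<in> basic_reps"
  by (auto simp: basic_reps_def smooth_nderiv)

lemma deriv_bound_nderiv:
  "deriv_bound K p (\<lambda>\<phi>. nderiv k (F \<phi>)) \<phi> w \<longleftrightarrow> deriv_bound K (p + k) F \<phi> w"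
  by (simp add: deriv_bound_def nderiv_nderiv)

text \<open>This is the Leibniz rule without binomial coefficients: (FG)' = FG' + F'G, and the
  induction hypothesis, general in \<open>F\<close> and \<open>G\<close>, applies to both products.
  Passing to F' or G' uses up one order of derivative, so bounds are assumed for all i \<le>
  p.\<close>

lemma deriv_bound_mult:
  assumes "F \<in> basic_reps" "G \<in> basic_reps" "\<phi> \<in> mollifiers q"
    and "\<And>i. i \<le> p \<Longrightarrow> deriv_bound K i F \<phi> v" "\<And>i. i \<le> p \<Longrightarrow> deriv_bound K i G \<phi> w"
  shows "deriv_bound K p (\<lambda>\<phi> x. F \<phi> x * G \<phi> x) \<phi> (\<lambda>\<epsilon>. v \<epsilon> * w \<epsilon>)"
  using assms
proof (induction p arbitrary: F G)
  case 0
  obtain c d where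
      "\<forall>\<^sub>F \<epsilon> in at_right 0. \<forall>x\<in>K. norm (F (scaled \<phi> \<epsilon>) x) \<le> c * v \<epsilon>"
      "\<forall>\<^sub>F \<epsilon> in at_right 0. \<forall>x\<in>K. norm (G (scaled \<phi> \<epsilon>) x) \<le> d * w \<epsilon>"
    using 0(4,5)[of 0] by (auto simp: deriv_bound_def)
  then have "\<forall>\<^sub>F \<epsilon> in at_right 0. \<forall>x\<in>K.
      norm (F (scaled \<phi> \<epsilon>) x * G (scaled \<phi> \<epsilon>) x) \<le> (c * d) * (v \<epsilon> * w \<epsilon>)"
  proof eventually_elim
    case (elim \<epsilon>)
    show ?case
    proof
      fix x assume "x \<in> K"
      then have "norm (F (scaled \<phi> \<epsilon>) x) * norm (G (scaled \<phi> \<epsilon>) x) \<le> (c * v \<epsilon>) * (d * w \<epsilon>)"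
        using elim by (intro mult_mono) (auto intro: order_trans[OF norm_ge_zero])
      then show "norm (F (scaled \<phi> \<epsilon>) x * G (scaled \<phi> \<epsilon>) x) \<le> (c * d) * (v \<epsilon> * w \<epsilon>)"
        by (simp add: norm_mult mult_ac)
    qed
  qed
  then show ?case
    by (auto simp: deriv_bound_def)
next
  case (Suc p)
  let ?F' = "\<lambda>\<phi>. nderiv 1 (F \<phi>)" and ?G' = "\<lambda>\<phi>. nderiv 1 (G \<phi>)"
  have b: "deriv_bound K p (\<lambda>\<phi> x. F \<phi> x * ?G' \<phi> x) \<phi> (\<lambda>\<epsilon>. v \<epsilon> * w \<epsilon>)"
      "deriv_bound K p (\<lambda>\<phi> x. ?F' \<phi> x * G \<phi> x) \<phi> (\<lambda>\<epsilon>. v \<epsilon> * w \<epsilon>)"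
    using Suc.prems by (auto intro!: Suc.IH basic_reps_nderiv simp: deriv_bound_nderiv)
  have "deriv_bound K p (\<lambda>\<phi> x. F \<phi> x * ?G' \<phi> x + ?F' \<phi> x * G \<phi> x) \<phi> (\<lambda>\<epsilon>. v \<epsilon> * w \<epsilon>)"
    using Suc.prems(1-3) b
    by (intro deriv_bound_add[where q = q] basic_reps_mult basic_reps_nderiv)
  then obtain c where "\<forall>\<^sub>F \<epsilon> in at_right 0. \<forall>x\<in>K. norm (nderiv p (\<lambda>x.
      F (scaled \<phi> \<epsilon>) x * ?G' (scaled \<phi> \<epsilon>) x + ?F' (scaled \<phi> \<epsilon>) x * G (scaled \<phi> \<epsilon>) x) x)
      \<le> c * (v \<epsilon> * w \<epsilon>)"
    by (auto simp: deriv_bound_def)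
  with eventually_basic_reps[OF Suc.prems(1,3)] eventually_basic_reps[OF Suc.prems(2,3)]
  have "\<forall>\<^sub>F \<epsilon> in at_right 0. \<forall>x\<in>K.
      norm (nderiv (Suc p) (\<lambda>x. F (scaled \<phi> \<epsilon>) x * G (scaled \<phi> \<epsilon>) x) x) \<le> c * (v \<epsilon> * w \<epsilon>)"
  proof eventually_elim
    case (elim \<epsilon>)
    have "nderiv 1 (\<lambda>x. F (scaled \<phi> \<epsilon>) x * G (scaled \<phi> \<epsilon>) x) = (\<lambda>x.
      F (scaled \<phi> \<epsilon>) x * ?G' (scaled \<phi> \<epsilon>) x + ?F' (scaled \<phi> \<epsilon>) x * G (scaled \<phi> \<epsilon>) x)"
      using elim(1,2) by (intro ext nderiv_1_mult) (metis nderiv_0 smooth_def)+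
    then have "nderiv (Suc p) (\<lambda>x. F (scaled \<phi> \<epsilon>) x * G (scaled \<phi> \<epsilon>) x) = nderiv p (\<lambda>x.
      F (scaled \<phi> \<epsilon>) x * ?G' (scaled \<phi> \<epsilon>) x + ?F' (scaled \<phi> \<epsilon>) x * G (scaled \<phi> \<epsilon>) x)"
      using nderiv_nderiv[of p 1] by (metis Suc_eq_plus1)
    with elim show ?case
      by simp
  qed
  then show ?case
    by (auto simp: deriv_bound_def)
qed

section \<open>Orders of growth and decay; the null representatives as a differential ideal\<close>

lemma uniform_order:
  fixes P :: "nat \<Rightarrow> nat \<Rightarrow> bool"
  assumes "\<And>i. i \<le> p \<Longrightarrow> \<exists>q. P i q" "\<And>i q q'. P i q \<Longrightarrow> q \<le> q' \<Longrightarrow> P i q'"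
  obtains q where "\<And>i. i \<le> p \<Longrightarrow> P i q"
proof -
  obtain Q where Q: "\<And>i. i \<le> p \<Longrightarrow> P i (Q i)"
    using assms(1) by metis
  \<comment> \<open>The product rule needs one order for all derivatives up to p; the largest of
    finitely many works because orders can be raised.\<close>
  have "P i (Max (Q ` {..p}))" if "i \<le> p" for i
    using Q[OF that] by (rule assms(2)) (use that in auto)
  then show ?thesis
    using that by blast
qed

definition moderate_order :: "representative \<Rightarrow> real set \<Rightarrow> nat \<Rightarrow> nat \<Rightarrow> bool" where
  "moderate_order F K p q \<longleftrightarrow> (\<forall>\<phi>\<in>mollifiers q. deriv_bound K p F \<phi> (\<lambda>\<epsilon>. 1 / \<epsilon> ^ q))"

definition null_order :: "representative \<Rightarrow> real set \<Rightarrow> nat \<Rightarrow> nat \<Rightarrow> bool" where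
  "null_order F K p q \<longleftrightarrow> (\<forall>r\<ge>q. \<forall>\<phi>\<in>mollifiers r. deriv_bound K p F \<phi> (\<lambda>\<epsilon>. \<epsilon> ^ (r - q)))"

lemma moderate_order_mono:
  assumes "moderate_order F K p q" "q \<le> q'"
  shows "moderate_order F K p q'"
  unfolding moderate_order_def
proof
  fix \<phi> assume "\<phi> \<in> mollifiers q'"
  then have "deriv_bound K p F \<phi> (\<lambda>\<epsilon>. 1 / \<epsilon> ^ q)"
    using assms mollifiers_antimono by (auto simp: moderate_order_def)
  then show "deriv_bound K p F \<phi> (\<lambda>\<epsilon>. 1 / \<epsilon> ^ q')"
  proof (rule deriv_bound_mono)
    show "\<forall>\<^sub>F \<epsilon> in at_right 0. 0 \<le> 1 / \<epsilon> ^ q \<and> 1 / \<epsilon> ^ q \<le> 1 / (\<epsilon>::real) ^ q'"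
      using eventually_at_right_0[OF zero_less_one]
      by eventually_elim (use assms(2) in \<open>auto intro!: divide_left_mono power_decreasing\<close>)
  qed
qed

text \<open>Raising q leaves fewer r to test and lowers the exponent r - q, a weaker demand for 0 <
  \<epsilon> < 1.\<close>

lemma null_order_mono:
  assumes "null_order F K p q" "q \<le> q'"
  shows "null_order F K p q'"
  unfolding null_order_def
proof (intro allI impI ballI)
  fix r \<phi> assume "q' \<le> r" "\<phi> \<in> mollifiers r"
  then have "deriv_bound K p F \<phi> (\<lambda>\<epsilon>. \<epsilon> ^ (r - q))"
    using assms by (auto simp: null_order_def)
  then show "deriv_bound K p F \<phi> (\<lambda>\<epsilon>. \<epsilon> ^ (r - q'))"
  proof (rule deriv_bound_mono)
    show "\<forall>\<^sub>F \<epsilon> in at_right 0. 0 \<le> \<epsilon> ^ (r - q) \<and> \<epsilon> ^ (r - q) \<le> (\<epsilon>::real) ^ (r - q')"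
      using eventually_at_right_0[OF zero_less_one]
      by eventually_elim (use assms(2) in \<open>auto intro!: power_decreasing\<close>)
  qed
qed

text \<open>Orders can be raised, so any witness can be exchanged for one that is at least 1, as the
  definition asks.\<close>

lemma moderate_reps_iff:
  "F \<in> moderate_reps \<longleftrightarrow>
     F \<in> basic_reps \<and> (\<forall>K p. compact K \<and> K \<noteq> {} \<longrightarrow> (\<exists>q. moderate_order F K p q))"
proof -
  have "(\<exists>q\<ge>1. \<forall>\<phi>\<in>mollifiers q.
        (\<lambda>\<epsilon>. SUP x\<in>K. norm (nderiv p (F (scaled \<phi> \<epsilon>)) x)) \<in> O[at_right 0](\<lambda>\<epsilon>. 1 / \<epsilon> ^ q)) \<longleftrightarrow>
      (\<exists>q. moderate_order F K p q)" if "F \<in> basic_reps" "compact K" "K \<noteq> {}" for K p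
  proof -
    have "(\<exists>q. moderate_order F K p q) \<longleftrightarrow> (\<exists>q\<ge>1. moderate_order F K p q)"
      using moderate_order_mono by (meson nat_le_linear)
    then show ?thesis
      using that unfolding moderate_order_def by (simp add: deriv_bound_iff cong: conj_cong)
  qed
  then show ?thesis
    unfolding moderate_reps_def mem_Collect_eq by meson
qed

lemma null_reps_iff:
  "F \<in> null_reps \<longleftrightarrow>
     F \<in> basic_reps \<and> (\<forall>K p. compact K \<and> K \<noteq> {} \<longrightarrow> (\<exists>q. null_order F K p q))"
proof -
  have "(\<exists>q\<ge>1. \<forall>r\<ge>q. \<forall>\<phi>\<in>mollifiers r.
        (\<lambda>\<epsilon>. SUP x\<in>K. norm (nderiv p (F (scaled \<phi> \<epsilon>)) x)) \<in> O[at_right 0](\<lambda>\<epsilon>. \<epsilon> ^ (r - q))) \<longleftrightarrow>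
      (\<exists>q. null_order F K p q)" if "F \<in> basic_reps" "compact K" "K \<noteq> {}" for K p
  proof -
    have "(\<exists>q. null_order F K p q) \<longleftrightarrow> (\<exists>q\<ge>1. null_order F K p q)"
      using null_order_mono by (meson nat_le_linear)
    then show ?thesis
      using that unfolding null_order_def by (simp add: deriv_bound_iff cong: conj_cong)
  qed
  then show ?thesis
    unfolding null_reps_def mem_Collect_eq by meson
qed

lemma moderate_reps_basic: "F \<in> moderate_reps \<Longrightarrow> F \<in> basic_reps"
  by (simp add: moderate_reps_def)

lemma null_reps_basic: "F \<in> null_reps \<Longrightarrow> F \<in> basic_reps"
  by (simp add: null_reps_def)

lemma moderate_reps_uniform:
  assumes "F \<in> moderate_reps" "compact K" "K \<noteq> {}"
  obtains q where "\<And>i. i \<le> p \<Longrightarrow> moderate_order F K i q"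
  using assms uniform_order[of p "moderate_order F K"] moderate_order_mono
  unfolding moderate_reps_iff by metis

lemma null_reps_uniform:
  assumes "F \<in> null_reps" "compact K" "K \<noteq> {}"
  obtains q where "\<And>i. i \<le> p \<Longrightarrow> null_order F K i q"
  using assms uniform_order[of p "null_order F K"] null_order_mono
  unfolding null_reps_iff by metis

lemma moderate_reps_mult:
  assumes "F \<in> moderate_reps" "G \<in> moderate_reps"
  shows "(\<lambda>\<phi> x. F \<phi> x * G \<phi> x) \<in> moderate_reps"
  unfolding moderate_reps_iff
proof (intro conjI allI impI)
  show "(\<lambda>\<phi> x. F \<phi> x * G \<phi> x) \<in> basic_reps"
    using assms by (intro basic_reps_mult moderate_reps_basic)
  fix K :: "real set" and p assume K: "compact K \<and> K \<noteq> {}"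
  obtain q1 where q1: "\<And>i. i \<le> p \<Longrightarrow> moderate_order F K i q1"
    using moderate_reps_uniform[of F K p] assms K by metis
  obtain q2 where q2: "\<And>i. i \<le> p \<Longrightarrow> moderate_order G K i q2"
    using moderate_reps_uniform[of G K p] assms K by metis
  have "moderate_order (\<lambda>\<phi> x. F \<phi> x * G \<phi> x) K p (q1 + q2)"
    unfolding moderate_order_def
  proof
    fix \<phi> assume \<phi>: "\<phi> \<in> mollifiers (q1 + q2)"
    then have "\<phi> \<in> mollifiers q1" "\<phi> \<in> mollifiers q2"
      using mollifiers_antimono le_add1 le_add2 by blast+
    with q1 q2 have "deriv_bound K p (\<lambda>\<phi> x. F \<phi> x * G \<phi> x) \<phi> (\<lambda>\<epsilon>. 1 / \<epsilon> ^ q1 * (1 / \<epsilon> ^ q2))"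
      using assms \<phi> by (intro deriv_bound_mult moderate_reps_basic) (auto simp: moderate_order_def)
    then show "deriv_bound K p (\<lambda>\<phi> x. F \<phi> x * G \<phi> x) \<phi> (\<lambda>\<epsilon>. 1 / \<epsilon> ^ (q1 + q2))"
      by (simp add: power_add)
  qed
  then show "\<exists>q. moderate_order (\<lambda>\<phi> x. F \<phi> x * G \<phi> x) K p q" ..
qed

text \<open>The ideal property. The moderate factor costs q1 powers of \<epsilon>, which lowers the
  exponent r - q2 to r - (q1 + q2); hence the order of the product is the sum.\<close>

lemma null_reps_mult:
  assumes "F \<in> moderate_reps" "G \<in> null_reps"
  shows "(\<lambda>\<phi> x. F \<phi> x * G \<phi> x) \<in> null_reps"
  unfolding null_reps_iff
proof (intro conjI allI impI)
  show "(\<lambda>\<phi> x. F \<phi> x * G \<phi> x) \<in> basic_reps"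
    using assms by (intro basic_reps_mult moderate_reps_basic null_reps_basic)
  fix K :: "real set" and p assume K: "compact K \<and> K \<noteq> {}"
  obtain q1 where q1: "\<And>i. i \<le> p \<Longrightarrow> moderate_order F K i q1"
    using moderate_reps_uniform[of F K p] assms K by metis
  obtain q2 where q2: "\<And>i. i \<le> p \<Longrightarrow> null_order G K i q2"
    using null_reps_uniform[of G K p] assms K by metis
  have "null_order (\<lambda>\<phi> x. F \<phi> x * G \<phi> x) K p (q1 + q2)"
    unfolding null_order_def
  proof (intro allI impI ballI)
    fix r \<phi> assume r: "q1 + q2 \<le> r" and \<phi>: "\<phi> \<in> mollifiers r"
    then have "\<phi> \<in> mollifiers q1"
      using mollifiers_antimono[of q1 r] by auto
    with q1 q2 r \<phi> have "deriv_bound K p (\<lambda>\<phi> x. F \<phi> x * G \<phi> x) \<phi> (\<lambda>\<epsilon>. 1 / \<epsilon> ^ q1 * \<epsilon> ^ (r - q2))"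
      using assms by (intro deriv_bound_mult moderate_reps_basic null_reps_basic)
        (auto simp: moderate_order_def null_order_def)
    then show "deriv_bound K p (\<lambda>\<phi> x. F \<phi> x * G \<phi> x) \<phi> (\<lambda>\<epsilon>. \<epsilon> ^ (r - (q1 + q2)))"
    proof (rule deriv_bound_mono)
      \<comment> \<open>Subtraction of naturals is exact here because q1 + q2 \<le> r.\<close>
      have "(r - q2) = q1 + (r - (q1 + q2))"
        using r by simp
      then have "\<epsilon> ^ (r - q2) = \<epsilon> ^ q1 * \<epsilon> ^ (r - (q1 + q2))" for \<epsilon> :: real
        by (metis power_add)
      then show "\<forall>\<^sub>F \<epsilon> in at_right 0. 0 \<le> 1 / \<epsilon> ^ q1 * \<epsilon> ^ (r - q2) \<and>
          1 / \<epsilon> ^ q1 * \<epsilon> ^ (r - q2) \<le> (\<epsilon>::real) ^ (r - (q1 + q2))"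
        using eventually_at_right_0[OF zero_less_one] by (auto elim!: eventually_mono)
    qed
  qed
  then show "\<exists>q. null_order (\<lambda>\<phi> x. F \<phi> x * G \<phi> x) K p q" ..
qed

lemma moderate_reps_nderiv: "F \<in> moderate_reps \<Longrightarrow> (\<lambda>\<phi>. nderiv k (F \<phi>)) \<in> moderate_reps"
  by (auto simp: moderate_reps_iff basic_reps_nderiv moderate_order_def deriv_bound_nderiv)

lemma null_reps_nderiv: "F \<in> null_reps \<Longrightarrow> (\<lambda>\<phi>. nderiv k (F \<phi>)) \<in> null_reps"
  by (auto simp: null_reps_iff basic_reps_nderiv null_order_def deriv_bound_nderiv)

text \<open>
  Needed because a representative need not be smooth off \<open>mollifiers 0\<close>, so that \<open>nderiv\<close> need not
  be additive there.
\<close>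

lemma null_reps_cong:
  assumes "F \<in> null_reps" and eq: "\<And>\<phi>. \<phi> \<in> mollifiers 0 \<Longrightarrow> F \<phi> = G \<phi>"
  shows "G \<in> null_reps"
proof -
  have "deriv_bound K p G \<phi> w" if bound: "deriv_bound K p F \<phi> w" and \<phi>: "\<phi> \<in> mollifiers q" for K p \<phi> w q
  proof -
    have *: "\<forall>\<^sub>F \<epsilon> in at_right 0. F (scaled \<phi> \<epsilon>) = G (scaled \<phi> \<epsilon>)"
      using eventually_at_right_0[OF zero_less_one]
    proof eventually_elim
      case (elim \<epsilon>)
      then show ?case
        using \<phi> scaled_mollifiers mollifiers_antimono[of 0 q] by (blast intro: eq)
    qed
    obtain c where "\<forall>\<^sub>F \<epsilon> in at_right 0. \<forall>x\<in>K. norm (nderiv p (F (scaled \<phi> \<epsilon>)) x) \<le> c * w \<epsilon>"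
      using bound unfolding deriv_bound_def by blast
    with * have "\<forall>\<^sub>F \<epsilon> in at_right 0. \<forall>x\<in>K. norm (nderiv p (G (scaled \<phi> \<epsilon>)) x) \<le> c * w \<epsilon>"
      by eventually_elim simp
    then show ?thesis
      by (auto simp: deriv_bound_def)
  qed
  then have "null_order G K p q" if "null_order F K p q" for K p q
    using that unfolding null_order_def by blast
  moreover have "G \<in> basic_reps"
    using null_reps_basic[OF assms(1)] eq by (simp add: basic_reps_def)
  ultimately show ?thesis
    using assms(1) unfolding null_reps_iff by meson
qed

lemma null_reps_add:
  assumes "F \<in> null_reps" "G \<in> null_reps"
  shows "(\<lambda>\<phi> x. F \<phi> x + G \<phi> x) \<in> null_reps"
  unfolding null_reps_iff
proof (intro conjI allI impI)
  show "(\<lambda>\<phi> x. F \<phi> x + G \<phi> x) \<in> basic_reps"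
    using assms by (intro basic_reps_add null_reps_basic)
  fix K :: "real set" and p assume K: "compact K \<and> K \<noteq> {}"
  obtain q1 q2 where "null_order F K p q1" "null_order G K p q2"
    using assms K unfolding null_reps_iff by metis
  then have "null_order F K p (max q1 q2)" "null_order G K p (max q1 q2)"
    by (auto elim: null_order_mono)
  then have "null_order (\<lambda>\<phi> x. F \<phi> x + G \<phi> x) K p (max q1 q2)"
    using assms unfolding null_order_def
    by (auto intro!: deriv_bound_add null_reps_basic)
  then show "\<exists>q. null_order (\<lambda>\<phi> x. F \<phi> x + G \<phi> x) K p q" ..
qed

lemma
  shows smooth_const: "smooth (\<lambda>_. c)"
    and nderiv_const: "nderiv p (\<lambda>_. c) = (if p = 0 then \<lambda>_. c else (\<lambda>_. 0))"
  using smoothI_nderiv[of "\<lambda>p _. if p = 0 then c else 0"] by auto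

lemma null_reps_zero: "(\<lambda>_ _. 0) \<in> null_reps"
proof -
  have "null_order (\<lambda>_ _. 0) K p 0" for K p
    unfolding null_order_def deriv_bound_def
    by (intro allI impI ballI exI[of _ 0] always_eventually) (simp add: nderiv_const)
  then show ?thesis
    unfolding null_reps_iff by (auto simp: basic_reps_def smooth_const)
qed

lemma moderate_reps_const: "(\<lambda>_ _. c) \<in> moderate_reps"
proof -
  have "moderate_order (\<lambda>_ _. c) K p 0" for K p
    unfolding moderate_order_def deriv_bound_def
    by (intro ballI exI[of _ "norm c"] always_eventually) (simp add: nderiv_const)
  then show ?thesis
    unfolding moderate_reps_iff by (auto simp: basic_reps_def smooth_const)
qed

lemma null_reps_minus: "F \<in> null_reps \<Longrightarrow> (\<lambda>\<phi> x. - F \<phi> x) \<in> null_reps"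
  using null_reps_mult[OF moderate_reps_const[of "-1"], of F] by simp

section \<open>The quotient and the operations on classes\<close>

lemma equiv_colombeau_rel: "equiv moderate_reps colombeau_rel"
proof (rule equivI)
  show "refl_on moderate_reps colombeau_rel"
    by (auto simp: refl_on_def colombeau_rel_def null_reps_zero)
  show "sym colombeau_rel"
    using null_reps_minus by (fastforce simp: sym_def colombeau_rel_def)
  show "trans colombeau_rel"
  proof (rule transI)
    fix F G H assume "(F, G) \<in> colombeau_rel" "(G, H) \<in> colombeau_rel"
    then show "(F, H) \<in> colombeau_rel"
      using null_reps_add[of "\<lambda>\<phi> x. F \<phi> x - G \<phi> x" "\<lambda>\<phi> x. G \<phi> x - H \<phi> x"]
      by (auto simp: colombeau_rel_def)
  qed
qed (auto simp: colombeau_rel_def)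

lemma gclass_in_colombeau_algebra: "F \<in> moderate_reps \<Longrightarrow> gclass F \<in> colombeau_algebra"
  by (simp add: gclass_def colombeau_algebra_def quotientI)

lemma gclass_self: "F \<in> moderate_reps \<Longrightarrow> F \<in> gclass F"
  using equiv_class_self[OF equiv_colombeau_rel] by (simp only: gclass_def)

lemma gclass_eqI: "(F, G) \<in> colombeau_rel \<Longrightarrow> gclass F = gclass G"
  by (simp add: gclass_def equiv_class_eq[OF equiv_colombeau_rel])

text \<open>\<open>gmult\<close> is a union of classes over all pairs of representatives; it is a
  single class because all the classes in the union coincide.\<close>

lemma gmult_gclass:
  assumes "F \<in> moderate_reps" "G \<in> moderate_reps"
  shows "gmult (gclass F) (gclass G) = gclass (\<lambda>\<phi> x. F \<phi> x * G \<phi> x)"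
proof -
  have "gclass (\<lambda>\<phi> x. F' \<phi> x * G' \<phi> x) = gclass (\<lambda>\<phi> x. F \<phi> x * G \<phi> x)"
    if "F' \<in> gclass F" "G' \<in> gclass G" for F' G'
  proof (rule gclass_eqI[symmetric])
    have F': "F' \<in> moderate_reps" "(\<lambda>\<phi> x. F \<phi> x - F' \<phi> x) \<in> null_reps"
      and G': "G' \<in> moderate_reps" "(\<lambda>\<phi> x. G \<phi> x - G' \<phi> x) \<in> null_reps"
      using that by (auto simp: gclass_def colombeau_rel_def)
    \<comment> \<open>Telescoping: FG - F'G' = F'(G - G') + G(F - F'), and each summand is a
      moderate representative times a null one.\<close>
    have "(\<lambda>\<phi> x. F' \<phi> x * (G \<phi> x - G' \<phi> x) + G \<phi> x * (F \<phi> x - F' \<phi> x)) \<in> null_reps"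
      using F' G' assms by (intro null_reps_add null_reps_mult)
    then have "(\<lambda>\<phi> x. F \<phi> x * G \<phi> x - F' \<phi> x * G' \<phi> x) \<in> null_reps"
      by (simp add: algebra_simps)
    then show "(\<lambda>\<phi> x. F \<phi> x * G \<phi> x, \<lambda>\<phi> x. F' \<phi> x * G' \<phi> x) \<in> colombeau_rel"
      using F' G' assms by (simp add: colombeau_rel_def moderate_reps_mult)
  qed
  then show ?thesis
    using gclass_self assms unfolding gmult_def by blast
qed

lemma gdiff_gclass:
  assumes "F \<in> moderate_reps"
  shows "gdiff (gclass F) = gclass (\<lambda>\<phi>. nderiv 1 (F \<phi>))"
proof -
  have "gclass (\<lambda>\<phi>. nderiv 1 (F' \<phi>)) = gclass (\<lambda>\<phi>. nderiv 1 (F \<phi>))"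
    if "F' \<in> gclass F" for F'
  proof (rule gclass_eqI[symmetric])
    have F': "F' \<in> moderate_reps" "(\<lambda>\<phi> x. F \<phi> x - F' \<phi> x) \<in> null_reps"
      using that by (auto simp: gclass_def colombeau_rel_def)
    have "(\<lambda>\<phi> x. nderiv 1 (F \<phi>) x - nderiv 1 (F' \<phi>) x) \<in> null_reps"
      using null_reps_nderiv[OF F'(2), of 1]
    proof (rule null_reps_cong)
      fix \<phi> :: "real \<Rightarrow> complex" assume "\<phi> \<in> mollifiers 0"
      then have "smooth (F \<phi>)" "smooth (F' \<phi>)"
        using F' assms moderate_reps_basic by (auto simp: basic_reps_def)
      then have "((\<lambda>x. F \<phi> x - F' \<phi> x) has_vector_derivative
          nderiv 1 (F \<phi>) x - nderiv 1 (F' \<phi>) x) (at x)" for x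
        using smooth_has_vector_derivative[of _ 0] by (auto intro: has_vector_derivative_diff)
      then show "nderiv 1 (\<lambda>x. F \<phi> x - F' \<phi> x) = (\<lambda>x. nderiv 1 (F \<phi>) x - nderiv 1 (F' \<phi>) x)"
        by (intro ext nderiv_1)
    qed
    then show "(\<lambda>\<phi>. nderiv 1 (F \<phi>), \<lambda>\<phi>. nderiv 1 (F' \<phi>)) \<in> colombeau_rel"
      using F' assms by (simp add: colombeau_rel_def moderate_reps_nderiv)
  qed
  then show ?thesis
    using gclass_self assms unfolding gdiff_def by blast
qed


section \<open>Convolution with the modelling functions\<close>

text \<open>The regularity shared by f, its derivative and the sign function. It allows convolution
  with test functions and tolerates a jump and an arbitrary value at 0.\<close>

definition locally_bounded :: "(real \<Rightarrow> complex) \<Rightarrow> bool" where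
  "locally_bounded f \<longleftrightarrow> f \<in> borel_measurable borel \<and> (\<forall>R. \<exists>B. \<forall>x\<in>{-R..R}. norm (f x) \<le> B)"

lemma locally_bounded_borel [measurable_dest]: "locally_bounded f \<Longrightarrow> f \<in> borel_measurable borel"
  by (simp add: locally_bounded_def)

lemma locally_boundedE:
  assumes "locally_bounded f"
  obtains B where "B > 0" "\<And>x. x \<in> {-R..R} \<Longrightarrow> norm (f x) \<le> B"
proof -
  obtain B where "\<forall>x\<in>{-R..R}. norm (f x) \<le> B"
    using assms by (auto simp: locally_bounded_def)
  then show ?thesis
    by (intro that[of "max B 1"]) (auto simp: le_max_iff_disj)
qed

text \<open>For |x| \<le> k only the values of f on [-(k+R), k+R] enter, an interval independent of
  x; this uniformity yields the bounds on compact sets that moderateness of the model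
  requires.\<close>

lemma
  assumes f: "locally_bounded f" and g: "g \<in> borel_measurable borel"
    and R: "{x. g x \<noteq> 0} \<subseteq> {-R..R}" "R \<ge> 0" and C: "\<And>x. norm (g x) \<le> C"
  shows convolution_integrable: "integrable lborel (\<lambda>y. f y * g (x - y))"
    and convolution_bound: "\<bar>x\<bar> \<le> k \<Longrightarrow> (\<And>y. y \<in> {-(k+R)..k+R} \<Longrightarrow> norm (f y) \<le> B) \<Longrightarrow>
      norm (convolution f g x) \<le> 2 * (k + R) * (B * C)"
proof -
  have m: "(\<lambda>y. f y * g (x - y)) \<in> borel_measurable borel"
    using f g by measurable
  have s: "{y. f y * g (x - y) \<noteq> 0} \<subseteq> {-(k+R)..k+R}" if "\<bar>x\<bar> \<le> k" for k
  proof
    fix y assume "y \<in> {y. f y * g (x - y) \<noteq> 0}"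
    then have "x - y \<in> {-R..R}"
      using R(1) by auto
    then show "y \<in> {-(k+R)..k+R}"
      using that by (auto simp: abs_le_iff)
  qed
  have b: "norm (f y * g (x - y)) \<le> B * C" if "norm (f y) \<le> B" for y B
    using that C by (auto simp: norm_mult intro!: mult_mono intro: order_trans[OF norm_ge_zero])
  obtain B' where "\<And>y. y \<in> {-(\<bar>x\<bar>+R)..\<bar>x\<bar>+R} \<Longrightarrow> norm (f y) \<le> B'"
    using locally_boundedE[OF f] by metis
  then show "integrable lborel (\<lambda>y. f y * g (x - y))"
    by (intro integrable_bounded_support[OF m s[of "\<bar>x\<bar>"], of "B' * C"] b) auto
  show "norm (convolution f g x) \<le> 2 * (k + R) * (B * C)"
    if "\<bar>x\<bar> \<le> k" "\<And>y. y \<in> {-(k+R)..k+R} \<Longrightarrow> norm (f y) \<le> B"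
    unfolding convolution_def
    by (intro integral_bounded_support[OF m s] b) (use that R in auto)
qed

text \<open>The mean value inequality is applied twice: it makes g' Lipschitz with constant
  \<open>B\<close>, and then bounds g minus its linear part on the segment. This gives the constant
  \<open>B\<close> rather than the sharp \<open>B / 2\<close>.\<close>

lemma taylor_bound:
  assumes "smooth g" and B: "\<And>x. norm (nderiv 2 g x) \<le> B"
  shows "norm (g v - g u - (v - u) *\<^sub>R nderiv 1 g u) \<le> B * (v - u)\<^sup>2"
proof -
  have d: "(nderiv p g has_vector_derivative nderiv (Suc p) g x) (at x within S)" for p x S
    using smooth_has_vector_derivative[OF assms(1)] has_vector_derivative_at_within by blast
  have lip: "norm (nderiv 1 g x - nderiv 1 g u) \<le> B * \<bar>v - u\<bar>"
    if "x \<in> closed_segment u v" for x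
  proof -
    have "norm (nderiv 1 g x - nderiv 1 g u) \<le> B * norm (x - u)"
    proof (rule differentiable_bound)
      show "(nderiv 1 g has_derivative (\<lambda>h. h *\<^sub>R nderiv 2 g x)) (at x within UNIV)" for x
        using d[of 1 x] by (simp add: has_vector_derivative_def numeral_2_eq_2)
      show "onorm (\<lambda>h. h *\<^sub>R nderiv 2 g x) \<le> B" for x
        using mult_left_mono[OF B abs_ge_zero] by (intro onorm_le) (simp add: mult.commute)
    qed auto
    also have "\<dots> \<le> B * \<bar>v - u\<bar>"
    proof (rule mult_left_mono)
      show "norm (x - u) \<le> \<bar>v - u\<bar>"
        using segment_bound1[OF that] by simp
      show "0 \<le> B"
        using order_trans[OF norm_ge_zero B] .
    qed
    finally show ?thesis .
  qed
  have "norm (g v - g u - (v - u) *\<^sub>R nderiv 1 g u) \<le> norm (v - u) * (B * \<bar>v - u\<bar>)"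
    using d[of 0] lip
    by (intro vector_differentiable_bound_linearization[where S = "closed_segment u v"]) auto
  then show ?thesis
    by (simp add: power2_eq_square mult_ac flip: abs_mult)
qed

text \<open>All smoothness comes from \<open>g\<close>. Its second-order Taylor remainder is uniform
  in the integration variable, so the difference quotient deviates from its limit by a multiple of
  |z - x|.\<close>

lemma convolution_has_vector_derivative:
  assumes f: "locally_bounded f" and g: "g \<in> test_functions"
  shows "(convolution f g has_vector_derivative convolution f (nderiv 1 g) x) (at x)"
proof -
  obtain R where R: "R > 0" "{x. g x \<noteq> 0} \<subseteq> {-R..R}"
    using test_functions_support[OF g] .
  have R': "{x. nderiv 1 g x \<noteq> 0} \<subseteq> {-R..R}"
    using R g by (intro nderiv_support test_functions_smooth) auto
  obtain B where B: "B > 0" "\<And>x. norm (nderiv 2 g x) \<le> B"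
    using test_functions_bounded[OF nderiv_test_functions[OF g]] by metis
  \<comment> \<open>For |z - x| < 1, both \<open>g (z - y)\<close> and \<open>g (x - y)\<close>
    vanish once |y| exceeds |x| + R + 1.\<close>
  let ?r = "\<bar>x\<bar> + R + 1"
  obtain A where A: "A > 0" "\<And>y. y \<in> {-?r..?r} \<Longrightarrow> norm (f y) \<le> A"
    using locally_boundedE[OF f] by metis
  have int: "integrable lborel (\<lambda>y. f y * u (z - y))" if u: "u \<in> test_functions" for u z
  proof -
    obtain R where "R > 0" "{x. u x \<noteq> 0} \<subseteq> {-R..R}"
      using test_functions_support[OF u] .
    moreover obtain B where "\<And>x. norm (u x) \<le> B"
      using test_functions_bounded[OF u] by metis
    ultimately show ?thesis
      using u by (intro convolution_integrable[OF f, of u R B]) auto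
  qed
  have est: "norm (convolution f g z - convolution f g x - (z - x) *\<^sub>R convolution f (nderiv 1 g) x)
      \<le> 2 * ?r * (A * (B * (z - x)\<^sup>2))" if z: "dist z x < 1" for z
  proof -
    let ?h = "\<lambda>y. f y * (g (z - y) - g (x - y) - (z - x) *\<^sub>R nderiv 1 g (x - y))"
    have "convolution f g z - convolution f g x - (z - x) *\<^sub>R convolution f (nderiv 1 g) x =
        (LINT y|lborel. f y * g (z - y) - f y * g (x - y)
          - (z - x) *\<^sub>R (f y * nderiv 1 g (x - y)))"
      unfolding convolution_def
      using int[OF g] int[OF nderiv_test_functions[OF g]] by simp
    also have "\<dots> = (LINT y|lborel. ?h y)"
      by (simp add: algebra_simps)
    also have "norm \<dots> \<le> 2 * ?r * (A * (B * (z - x)\<^sup>2))"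
    proof (rule integral_bounded_support)
      show "?h \<in> borel_measurable borel"
        using f g nderiv_test_functions[OF g, of 1] by measurable
      show "{y. ?h y \<noteq> 0} \<subseteq> {-?r..?r}"
      proof (rule subsetI, rule ccontr)
        fix y assume "y \<in> {y. ?h y \<noteq> 0}" "y \<notin> {-?r..?r}"
        then have "z - y \<notin> {-R..R}" "x - y \<notin> {-R..R}"
          using z by (auto simp: dist_real_def)
        then have "g (z - y) = 0" "g (x - y) = 0" "nderiv 1 g (x - y) = 0"
          using R R' by blast+
        then show False
          using \<open>y \<in> {y. ?h y \<noteq> 0}\<close> by simp
      qed
      show "norm (?h y) \<le> A * (B * (z - x)\<^sup>2)" if "y \<in> {-?r..?r}" for y
        unfolding norm_mult
        using taylor_bound[OF test_functions_smooth[OF g] B(2), of "z - y" "x - y"] A that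
        by (intro mult_mono) auto
      show "?r \<ge> 0"
        using R by simp
    qed
    finally show ?thesis .
  qed
  show ?thesis
    unfolding has_vector_derivative_def
  proof (rule has_derivativeI_sandwich[where e = 1])
    let ?H = "\<lambda>z. 2 * ?r * (A * (B * \<bar>z - x\<bar>))"
    show "bounded_linear (\<lambda>h. h *\<^sub>R convolution f (nderiv 1 g) x)"
      by (rule bounded_linear_scaleR_left)
    show "norm (convolution f g z - convolution f g x - (z - x) *\<^sub>R convolution f (nderiv 1 g) x)
        / norm (z - x) \<le> ?H z" if "z \<noteq> x" "dist z x < 1" for z
    proof -
      have "norm (z - x) > 0" and sq: "(z - x)\<^sup>2 = \<bar>z - x\<bar> * norm (z - x)"
        using that(1) by (simp_all add: power2_eq_square)
      then show ?thesis
        using est[OF that(2)] by (simp only: pos_divide_le_eq sq mult.assoc)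
    qed
    have "(?H \<longlongrightarrow> 2 * ?r * (A * (B * \<bar>x - x\<bar>))) (at x)"
      by (intro tendsto_intros)
    then show "(?H \<longlongrightarrow> 0) (at x)"
      by simp
  qed simp
qed

lemma
  assumes "locally_bounded f" "g \<in> test_functions"
  shows smooth_convolution: "smooth (convolution f g)"
    and nderiv_convolution: "nderiv p (convolution f g) = convolution f (nderiv p g)"
proof -
  have "(convolution f (nderiv p g) has_vector_derivative convolution f (nderiv (Suc p) g) x) (at x)"
    for p x
    using convolution_has_vector_derivative[OF assms(1) nderiv_test_functions[OF assms(2), of p]]
    by (simp add: nderiv_nderiv)
  from smoothI_nderiv[of "\<lambda>p. convolution f (nderiv p g)", OF this]
  show "smooth (convolution f g)" "nderiv p (convolution f g) = convolution f (nderiv p g)"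
    by simp_all
qed

section \<open>The dilated modelling family and moderateness of the model\<close>

lemma dilated_eq_scaled: "dilated D \<sigma> = scaled (D \<sigma>) \<sigma>"
  by (simp add: fun_eq_iff dilated_def scaled_def)

lemma integral_scaled:
  fixes h :: "complex \<Rightarrow> 'b::{banach, second_countable_topology}"
  assumes "\<epsilon> > 0"
  shows "(LINT x|lborel. h (scaled \<phi> \<epsilon> x)) = \<epsilon> *\<^sub>R (LINT x|lborel. h (\<phi> x / of_real \<epsilon>))"
  using assms lborel_integral_real_affine[of \<epsilon> "\<lambda>x. h (scaled \<phi> \<epsilon> x)" 0]
  by (simp add: scaled_def)

lemma
  assumes "delta_modelling D" "\<sigma> > 0"
  shows dilated_test_functions: "dilated D \<sigma> \<in> test_functions"
    and dilated_even: "dilated D \<sigma> (- x) = dilated D \<sigma> x"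
    and integral_dilated: "(LINT x|lborel. dilated D \<sigma> x) = 1"
    and integral_dilated_square: "(LINT x|lborel. (dilated D \<sigma> x)\<^sup>2) = 1"
proof -
  have D: "D \<sigma> \<in> test_functions" "\<And>x. D \<sigma> (- x) = D \<sigma> x" "(LINT x|lborel. (D \<sigma> x)\<^sup>2) / of_real \<sigma> = 1"
      "(LINT x|lborel. D \<sigma> x) = 1"
    using assms by (auto simp: delta_modelling_def)
  show "dilated D \<sigma> \<in> test_functions"
    unfolding dilated_eq_scaled by (intro scaled_test_functions D assms)
  show "dilated D \<sigma> (- x) = dilated D \<sigma> x"
    using D(2)[of "x / \<sigma>"] by (simp add: dilated_def)
  show "(LINT x|lborel. dilated D \<sigma> x) = 1"
    using integral_scaled[OF assms(2), of "\<lambda>z. z" "D \<sigma>"] D(4) assms(2)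
    by (simp add: dilated_eq_scaled scaleR_conv_of_real)
  \<comment> \<open>Squaring and substituting leaves one factor 1/\<sigma>, the very factor in the
    normalisation of \<open>delta_modelling\<close>.\<close>
  show "(LINT x|lborel. (dilated D \<sigma> x)\<^sup>2) = 1"
    using integral_scaled[OF assms(2), of "\<lambda>z. z\<^sup>2" "D \<sigma>"] D(3) assms(2)
    by (simp add: dilated_eq_scaled scaleR_conv_of_real power_divide power2_eq_square)
qed

text \<open>Dilation preserves the L1 norm and multiplies the squared L2 norm by 1/\<sigma>, hence
  the factor \<sigma> in the last bound. The L1 bound follows from |z| \<le> 1 + |z|^2 on the
  support, whence L = 2l + M; l and M are first raised to at least 1 to make all constants
  positive.\<close>

lemma bounded_profiles_dilated:
  assumes D: "delta_modelling D" and "bounded_profiles D"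
  obtains l L M where "l > 0" "L > 0" "M > 0"
    "\<forall>\<^sub>F \<sigma> in at_right 0. 0 < \<sigma> \<and> {x. dilated D \<sigma> x \<noteq> 0} \<subseteq> {-(l * \<sigma>)..l * \<sigma>} \<and>
      (LINT x|lborel. norm (dilated D \<sigma> x)) \<le> L \<and> \<sigma> * (LINT x|lborel. (norm (dilated D \<sigma> x))\<^sup>2) \<le> M"
proof -
  obtain l M where lM: "\<forall>\<^sub>F s in at_right 0.
     {x. D s x \<noteq> 0} \<subseteq> {-l..l} \<and> (LINT x|lborel. (norm (D s x))\<^sup>2) \<le> M"
    using assms(2) by (auto simp: bounded_profiles_def)
  define l' where "l' = max l 1"
  define M' where "M' = max M 1"
  have "l' > 0" "M' > 0" "l \<le> l'" "M \<le> M'"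
    by (auto simp: l'_def M'_def)
  have "\<forall>\<^sub>F \<sigma> in at_right 0. 0 < \<sigma> \<and> {x. dilated D \<sigma> x \<noteq> 0} \<subseteq> {-(l' * \<sigma>)..l' * \<sigma>} \<and>
      (LINT x|lborel. norm (dilated D \<sigma> x)) \<le> 2 * l' + M' \<and>
      \<sigma> * (LINT x|lborel. (norm (dilated D \<sigma> x))\<^sup>2) \<le> M'"
    using lM eventually_at_right_0[OF zero_less_one]
  proof eventually_elim
    case (elim \<sigma>)
    then have \<sigma>: "\<sigma> > 0" and supp: "{x. D \<sigma> x \<noteq> 0} \<subseteq> {-l'..l'}"
      and M: "(LINT x|lborel. (norm (D \<sigma> x))\<^sup>2) \<le> M'"
      using \<open>l \<le> l'\<close> \<open>M \<le> M'\<close> by auto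
    have Dt: "D \<sigma> \<in> test_functions"
      using D \<sigma> by (simp add: delta_modelling_def)
    have int: "integrable lborel (\<lambda>x. (norm (D \<sigma> x))\<^sup>2)"
      using integrable_norm[OF test_functions_integrable[OF
          test_functions_mult[OF Dt test_functions_smooth[OF Dt]]]]
      by (simp add: norm_mult power2_eq_square)
    have int1: "integrable lborel (\<lambda>x. indicator {-l'..l'} x :: real)"
      by (intro integrable_real_indicator) (auto simp: emeasure_lborel_Icc_eq)
    have "(LINT x|lborel. norm (D \<sigma> x)) \<le> (LINT x|lborel. indicator {-l'..l'} x + (norm (D \<sigma> x))\<^sup>2)"
    proof (rule integral_mono)
      show "norm (D \<sigma> x) \<le> indicator {-l'..l'} x + (norm (D \<sigma> x))\<^sup>2" for x
      proof (cases "D \<sigma> x = 0")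
        case False
        then have "x \<in> {-l'..l'}"
          using supp by auto
        moreover have "norm (D \<sigma> x) \<le> 1 + (norm (D \<sigma> x))\<^sup>2"
          using sum_squares_bound[of 1 "norm (D \<sigma> x)"] norm_ge_zero[of "D \<sigma> x"]
          unfolding power_one mult_1_right by linarith
        ultimately show ?thesis
          by simp
      qed (auto simp: indicator_def)
    qed (use int int1 test_functions_integrable[OF Dt] in auto)
    also have "\<dots> = (LINT x|lborel. indicator {-l'..l'} x) + (LINT x|lborel. (norm (D \<sigma> x))\<^sup>2)"
      by (rule Bochner_Integration.integral_add[OF int1 int])
    also have "\<dots> \<le> 2 * l' + M'"
      using M \<open>l' > 0\<close> by simp
    finally have "(LINT x|lborel. norm (dilated D \<sigma> x)) \<le> 2 * l' + M'"
      using integral_scaled[OF \<sigma>, of norm "D \<sigma>"] \<sigma> by (simp add: dilated_eq_scaled norm_divide)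
    moreover have "\<sigma> * (LINT x|lborel. (norm (dilated D \<sigma> x))\<^sup>2) \<le> M'"
      using integral_scaled[OF \<sigma>, of "\<lambda>z. (norm z)\<^sup>2" "D \<sigma>"] \<sigma> M
      by (simp add: dilated_eq_scaled norm_divide power_divide power2_eq_square)
    moreover have "{x. dilated D \<sigma> x \<noteq> 0} \<subseteq> {-(l' * \<sigma>)..l' * \<sigma>}"
    proof
      fix x assume "x \<in> {x. dilated D \<sigma> x \<noteq> 0}"
      then have "x / \<sigma> \<in> {-l'..l'}"
        using supp by (auto simp: dilated_def)
      then show "x \<in> {-(l' * \<sigma>)..l' * \<sigma>}"
        using \<sigma> by (simp add: field_simps)
    qed
    ultimately show ?case
      using \<sigma> by blast
  qed
  then show ?thesis
    using \<open>l' > 0\<close> \<open>M' > 0\<close> by (intro that[of l' "2 * l' + M'" M']) auto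
qed

text \<open>Turns every limit in \<sigma> into a limit in \<epsilon> along a fixed
  mollifier.\<close>

lemma filterlim_supp_radius_scaled:
  assumes "\<phi> \<in> mollifiers 0"
  shows "filterlim (\<lambda>\<epsilon>. supp_radius (scaled \<phi> \<epsilon>)) (at_right 0) (at_right 0)"
proof -
  have s: "supp_radius \<phi> > 0"
    by (rule supp_radius_pos[OF assms])
  have "((\<lambda>\<epsilon>. \<epsilon> * supp_radius \<phi>) \<longlongrightarrow> 0 * supp_radius \<phi>) (at_right 0)"
    by (intro tendsto_intros)
  then have "filterlim (\<lambda>\<epsilon>. \<epsilon> * supp_radius \<phi>) (at_right 0) (at_right 0)"
    using eventually_at_right_0[OF zero_less_one] s
    by (intro tendsto_imp_filterlim_at_right) (auto elim!: eventually_mono)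
  moreover have "\<forall>\<^sub>F \<epsilon> in at_right 0. supp_radius (scaled \<phi> \<epsilon>) = \<epsilon> * supp_radius \<phi>"
    using eventually_at_right_0[OF zero_less_one]
    by eventually_elim (simp add: supp_radius_scaled[OF assms])
  ultimately show ?thesis
    by (simp cong: filterlim_cong)
qed

text \<open>All derivatives of the convolution fall on the dilated function, whose support
  eventually lies in [-1,1]. The order of \<open>delta_rep D\<close> on this one interval therefore
  serves for every compact \<open>K\<close>, and f contributes only its bound on a 1-neighbourhood
  of an interval containing \<open>K\<close>.\<close>

lemma model_rep_moderate:
  assumes f: "locally_bounded f" and D: "delta_modelling D" "bounded_profiles D"
    and D_gen: "delta_rep D \<in> moderate_reps"
  shows "model_rep D f \<in> moderate_reps"
  unfolding moderate_reps_iff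
proof (intro conjI allI impI)
  show "model_rep D f \<in> basic_reps"
    unfolding basic_reps_def model_rep_def
    using smooth_convolution[OF f] dilated_test_functions[OF D(1)] supp_radius_pos by blast
  fix K :: "real set" and p assume K: "compact K \<and> K \<noteq> {}"
  obtain k where k: "\<And>x. x \<in> K \<Longrightarrow> \<bar>x\<bar> \<le> k"
    using K compact_imp_bounded[of K] by (auto simp: bounded_real)
  have "k \<ge> 0"
    using K k by force
  obtain q where q: "moderate_order (delta_rep D) {-1..1} p q"
    using D_gen unfolding moderate_reps_iff by fastforce
  obtain B where B: "B > 0" "\<And>y. y \<in> {-(k+1)..k+1} \<Longrightarrow> norm (f y) \<le> B"
    using locally_boundedE[OF f] by metis
  have "moderate_order (model_rep D f) K p q"
    unfolding moderate_order_def
  proof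
    fix \<phi> :: "real \<Rightarrow> complex" assume \<phi>: "\<phi> \<in> mollifiers q"
    then have \<phi>0: "\<phi> \<in> mollifiers 0"
      using mollifiers_antimono by blast
    let ?e = "\<lambda>\<epsilon>. dilated D (supp_radius (scaled \<phi> \<epsilon>))"
    obtain c where c: "\<forall>\<^sub>F \<epsilon> in at_right 0. \<forall>x\<in>{-1..1}. norm (nderiv p (?e \<epsilon>) x) \<le> c * (1 / \<epsilon> ^ q)"
      using q \<phi> unfolding moderate_order_def deriv_bound_def delta_rep_def by blast
    obtain l L M where "l > 0" "L > 0" "M > 0" and l: "\<forall>\<^sub>F \<sigma> in at_right 0. 0 < \<sigma> \<and> {x. dilated D \<sigma> x \<noteq> 0} \<subseteq> {-(l * \<sigma>)..l * \<sigma>} \<and>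
      (LINT x|lborel. norm (dilated D \<sigma> x)) \<le> L \<and> \<sigma> * (LINT x|lborel. (norm (dilated D \<sigma> x))\<^sup>2) \<le> M"
      by (rule bounded_profiles_dilated[OF D])
    have "\<forall>\<^sub>F \<sigma> in at_right 0. \<sigma> > 0 \<and> {x. dilated D \<sigma> x \<noteq> 0} \<subseteq> {-1..1}"
      using l eventually_at_right_0[OF divide_pos_pos[OF zero_less_one \<open>l > 0\<close>]]
    proof (eventually_elim, safe)
      fix \<sigma> x assume *: "0 < \<sigma>" "\<sigma> < 1 / l" "{x. dilated D \<sigma> x \<noteq> 0} \<subseteq> {-(l * \<sigma>)..l * \<sigma>}" "dilated D \<sigma> x \<noteq> 0"
      then have "x \<in> {-(l * \<sigma>)..l * \<sigma>}" "l * \<sigma> \<le> 1"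
        using \<open>l > 0\<close> by (auto simp: field_simps)
      then show "x \<in> {-1..1}"
        by auto
    qed
    then have "\<forall>\<^sub>F \<epsilon> in at_right 0. supp_radius (scaled \<phi> \<epsilon>) > 0 \<and> {x. ?e \<epsilon> x \<noteq> 0} \<subseteq> {-1..1}"
      using filterlim_supp_radius_scaled[OF \<phi>0] by (rule eventually_compose_filterlim)
    with c have "\<forall>\<^sub>F \<epsilon> in at_right 0. \<forall>x\<in>K.
        norm (nderiv p (convolution f (?e \<epsilon>)) x) \<le> 2 * (k + 1) * B * c * (1 / \<epsilon> ^ q)"
    proof eventually_elim
      case (elim \<epsilon>)
      have e: "?e \<epsilon> \<in> test_functions"
        using elim D by (intro dilated_test_functions) auto
      have s: "{x. nderiv p (?e \<epsilon>) x \<noteq> 0} \<subseteq> {-1..1}"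
        using e elim by (intro nderiv_support test_functions_smooth) auto
      \<comment> \<open>The bound on [-1,1] extends to the whole line: outside, the derivative
        vanishes, and the right-hand side is nonnegative because it dominates a norm at 0.\<close>
      have b: "norm (nderiv p (?e \<epsilon>) x) \<le> c * (1 / \<epsilon> ^ q)" for x
      proof (cases "x \<in> {-1..1}")
        case False
        then have "nderiv p (?e \<epsilon>) x = 0"
          using s by blast
        moreover have "0 \<le> c * (1 / \<epsilon> ^ q)"
          using elim by (intro order_trans[OF norm_ge_zero[of "nderiv p (?e \<epsilon>) 0"]]) auto
        ultimately show ?thesis
          by simp
      qed (use elim in blast)
      show ?case
      proof
        fix x assume "x \<in> K"
        then have "norm (convolution f (nderiv p (?e \<epsilon>)) x) \<le> 2 * (k + 1) * (B * (c * (1 / \<epsilon> ^ q)))"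
          using b B(2) k s test_functions_borel[OF nderiv_test_functions[OF e]]
          by (intro convolution_bound f) auto
        then show "norm (nderiv p (convolution f (?e \<epsilon>)) x) \<le> 2 * (k + 1) * B * c * (1 / \<epsilon> ^ q)"
          by (simp add: nderiv_convolution[OF f e])
      qed
    qed
    then show "deriv_bound K p (model_rep D f) \<phi> (\<lambda>\<epsilon>. 1 / \<epsilon> ^ q)"
      unfolding deriv_bound_def model_rep_def by blast
  qed
  then show "\<exists>q. moderate_order (model_rep D f) K p q" ..
qed


section \<open>Functions with a jump at the origin\<close>

text \<open>The value at 0 is arbitrary, so it is overwritten by the one-sided limit; compactness
  and the fundamental theorem of calculus then apply on each closed half.\<close>

lemma continuous_on_jump:
  fixes u :: "real \<Rightarrow> 'a::real_normed_vector"
  assumes "\<And>x. x \<noteq> 0 \<Longrightarrow> isCont u x"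
    and "(u \<longlongrightarrow> up) (at_right 0)" "(u \<longlongrightarrow> um) (at_left 0)" and "R > 0"
  shows "continuous_on {0..R} (u(0 := up))" "continuous_on {-R..0} (u(0 := um))"
proof -
  have lim: "(u(0 := c) \<longlongrightarrow> u x) F" if "(u \<longlongrightarrow> u x) F" "F \<le> at x" "x \<noteq> 0" for c x F
  proof -
    have "\<forall>\<^sub>F y in at x. y \<noteq> 0"
      using that(3) by (intro eventually_neq_at_within)
    then have "\<forall>\<^sub>F y in F. y \<noteq> 0"
      by (rule filter_leD[OF that(2)])
    then have "\<forall>\<^sub>F y in F. u y = (u(0 := c)) y"
      by eventually_elim simp
    then show ?thesis
      using that(1) by (rule Lim_transform_eventually[rotated])
  qed
  have lim0: "(u(0 := c) \<longlongrightarrow> l) (at 0 within S)" if "(u \<longlongrightarrow> l) (at 0 within S)" for c l S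
    using that by (rule Lim_transform_eventually) (auto simp: eventually_at_filter)
  have c: "(u \<longlongrightarrow> u x) (at x within S)" if "x \<noteq> 0" for x S
    using assms(1)[OF that] by (simp add: isCont_def tendsto_within_subset[where S=UNIV])
  show "continuous_on {0..R} (u(0 := up))"
    using assms by (intro continuous_on_IccI) (auto intro!: lim lim0 c at_le)
  show "continuous_on {-R..0} (u(0 := um))"
    using assms by (intro continuous_on_IccI) (auto intro!: lim lim0 c at_le)
qed

lemma locally_bounded_jump:
  assumes u: "\<And>x. x \<noteq> 0 \<Longrightarrow> isCont u x"
    "(u \<longlongrightarrow> up) (at_right 0)" "(u \<longlongrightarrow> um) (at_left 0)"
  shows "locally_bounded u"
  unfolding locally_bounded_def
proof (intro conjI allI)
  show "u \<in> borel_measurable borel"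
  proof (rule borel_measurable_continuous_countable_exceptions[of "{0}"])
    show "continuous_on (- {0}) u"
      using u(1) by (intro continuous_at_imp_continuous_on) auto
  qed auto
  fix R :: real
  \<comment> \<open>\<open>continuous_on_jump\<close> asks for a positive radius, while
    \<open>R\<close> is arbitrary.\<close>
  define r where "r = max R 1"
  have "bounded (u(0 := up) ` {0..r})" "bounded (u(0 := um) ` {-r..0})"
    by (intro compact_imp_bounded compact_continuous_image continuous_on_jump[OF u] compact_Icc;
        simp add: r_def)+
  then obtain A B where AB: "\<And>x. x \<in> {0..r} \<Longrightarrow> norm ((u(0 := up)) x) \<le> A"
      "\<And>x. x \<in> {-r..0} \<Longrightarrow> norm ((u(0 := um)) x) \<le> B"
    unfolding bounded_iff by (meson imageI)
  show "\<exists>B. \<forall>x\<in>{-R..R}. norm (u x) \<le> B"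
  proof (intro exI ballI)
    fix x assume "x \<in> {-R..R}"
    then have "x \<in> {-r..r}"
      by (auto simp: r_def)
    \<comment> \<open>The bounds A and B concern the overwritten functions, so the true value at 0
      is added to the maximum.\<close>
    then show "norm (u x) \<le> max (norm (u 0)) (max A B)"
      using AB[of x] by (cases x "0::real" rule: linorder_cases) (auto simp: le_max_iff_disj)
  qed
qed

text \<open>The fundamental theorem on each side of 0; the outer endpoints lie beyond the support,
  so only the two limits at 0 survive.\<close>

lemma integral_derivative_jump:
  fixes u :: "real \<Rightarrow> complex"
  assumes u: "\<And>x. x \<noteq> 0 \<Longrightarrow> (u has_vector_derivative u' x) (at x)"
    "(u \<longlongrightarrow> up) (at_right 0)" "(u \<longlongrightarrow> um) (at_left 0)"
    and supp: "{x. u x \<noteq> 0} \<subseteq> {-R..R}" "{x. u' x \<noteq> 0} \<subseteq> {-R..R}"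
    and int: "integrable lborel u'"
  shows "(LINT x|lborel. u' x) = um - up"
proof -
  \<comment> \<open>\<open>R\<close> may be negative; the choice gives r > 0 and puts both r and -r
    strictly outside the support.\<close>
  define r where "r = max R 0 + 1"
  have r: "r > 0" "r \<notin> {-R..R}" "-r \<notin> {-R..R}"
    by (auto simp: r_def)
  then have out: "u r = 0" "u (-r) = 0"
    using supp by blast+
  have cont: "isCont u x" if "x \<noteq> 0" for x
    using u(1)[OF that] by (rule has_vector_derivative_continuous)
  have d: "(u(0 := c) has_vector_derivative u' x) (at x)" if "x \<noteq> 0" for x c
    using u(1)[OF that] by (rule has_vector_derivative_transform_within_open[where S = "-{0}"])
      (use that in auto)
  have "(u' has_integral (u(0 := up)) r - (u(0 := up)) 0) {0..r}"
    using r by (intro fundamental_theorem_of_calculus_interior continuous_on_jump[OF cont u(2,3)] d) auto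
  moreover have "(u' has_integral (u(0 := um)) 0 - (u(0 := um)) (-r)) {-r..0}"
    using r by (intro fundamental_theorem_of_calculus_interior continuous_on_jump[OF cont u(2,3)] d) auto
  ultimately have "(u' has_integral um - up) {-r..r}"
    using has_integral_combine[of "-r" 0 r u' um "- up"] r out by simp
  then have "(u' has_integral um - up) UNIV"
    by (rule has_integral_on_superset) (use supp in \<open>auto simp: r_def\<close>)
  with has_integral_integral_lborel[OF int] show ?thesis
    by (rule has_integral_unique)
qed

text \<open>The case without a jump. Applied to a product of functions, it is integration by
  parts.\<close>

lemma integral_nderiv_test_function:
  assumes w: "w \<in> test_functions"
  shows "(LINT x|lborel. nderiv 1 w x) = 0"
proof -
  obtain R where R: "{x. w x \<noteq> 0} \<subseteq> {-R..R}"
    using test_functions_support[OF w] .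
  have sm: "smooth w"
    by (rule test_functions_smooth[OF w])
  have "isCont w 0"
    using smooth_has_vector_derivative[OF sm, of 0] by (auto intro: has_vector_derivative_continuous)
  then have "(w \<longlongrightarrow> w 0) (at 0 within S)" for S
    by (simp add: isCont_def tendsto_within_subset[where S=UNIV])
  then have "(LINT x|lborel. nderiv 1 w x) = w 0 - w 0"
    using smooth_has_vector_derivative[OF sm, of 0] R nderiv_support[OF sm R, of 1]
      test_functions_integrable[OF nderiv_test_functions[OF w]]
    by (intro integral_derivative_jump[where u = w and R = R]) auto
  then show ?thesis
    by simp
qed

lemma integral_odd:
  fixes h :: "real \<Rightarrow> complex"
  assumes "\<And>x. h (- x) = - h x"
  shows "(LINT x|lborel. h x) = 0"
  using lborel_integral_real_affine[of "-1" h 0] by (simp add: assms)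

text \<open>The derivative of the convolution falls on e; the jump formula moves it to f. It is
  applied to f(y) e(x - y) as a function of y, whose one-sided limits at 0 are fp e(x) and fm
  e(x).\<close>

lemma nderiv_convolution_jump:
  assumes f: "\<And>x. x \<noteq> 0 \<Longrightarrow> (f has_vector_derivative f' x) (at x)"
    "(f \<longlongrightarrow> fp) (at_right 0)" "(f \<longlongrightarrow> fm) (at_left 0)"
    and f': "locally_bounded f'" and e: "e \<in> test_functions"
  shows "nderiv 1 (convolution f e) x = (fp - fm) * e x + convolution f' e x"
proof -
  obtain R where R: "R > 0" "{x. e x \<noteq> 0} \<subseteq> {-R..R}"
    using test_functions_support[OF e] .
  have sm: "smooth e"
    by (rule test_functions_smooth[OF e])
  have R': "{x. nderiv 1 e x \<noteq> 0} \<subseteq> {-R..R}"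
    using R sm by (intro nderiv_support) auto
  have lb: "locally_bounded f"
    using f by (intro locally_bounded_jump) (auto intro: has_vector_derivative_continuous)
  have int: "integrable lborel (\<lambda>y. h y * nderiv p e (x - y))" if h: "locally_bounded h" for h p
  proof -
    obtain B where "\<And>x. norm (nderiv p e x) \<le> B"
      using test_functions_bounded[OF nderiv_test_functions[OF e]] by metis
    then show ?thesis
      using R nderiv_support[OF sm R(2), of p] test_functions_borel[OF nderiv_test_functions[OF e]]
      by (intro convolution_integrable[OF h, of _ R B]) auto
  qed
  have int0: "integrable lborel (\<lambda>y. f' y * e (x - y))"
    using int[OF f', of 0] by simp
  let ?u = "\<lambda>y. f y * e (x - y)" and ?u' = "\<lambda>y. f' y * e (x - y) - f y * nderiv 1 e (x - y)"
  have de: "((\<lambda>y. e (x - y)) has_vector_derivative - nderiv 1 e (x - y)) (at y)" for y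
  proof -
    have "((\<lambda>y. x - y) has_vector_derivative - 1) (at y)"
      by (auto intro!: derivative_eq_intros)
    from vector_diff_chain_at[OF this, of e] smooth_has_vector_derivative[OF sm, of 0 "x - y"]
    show ?thesis
      by (simp add: o_def)
  qed
  then have "isCont (\<lambda>y. e (x - y)) 0"
    by (rule has_vector_derivative_continuous)
  then have lim: "((\<lambda>y. e (x - y)) \<longlongrightarrow> e x) (at 0 within S)" for S
    by (simp add: isCont_def tendsto_within_subset[where S=UNIV])
  have "(LINT y|lborel. ?u' y) = fm * e x - fp * e x"
  proof (rule integral_derivative_jump[where u = ?u])
    show "(?u has_vector_derivative ?u' y) (at y)" if "y \<noteq> 0" for y
      using has_vector_derivative_mult[OF f(1)[OF that] de[of y]] by (simp add: algebra_simps)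
    show "(?u \<longlongrightarrow> fp * e x) (at_right 0)" "(?u \<longlongrightarrow> fm * e x) (at_left 0)"
      by (intro tendsto_mult f lim)+
    have out: "?u y = 0" "?u' y = 0" if "y \<notin> {-(\<bar>x\<bar> + R)..\<bar>x\<bar> + R}" for y
    proof -
      from that have "x - y \<notin> {-R..R}"
        by auto
      then have "e (x - y) = 0" "nderiv 1 e (x - y) = 0"
        using R R' by blast+
      then show "?u y = 0" "?u' y = 0"
        by simp_all
    qed
    show "{y. ?u y \<noteq> 0} \<subseteq> {-(\<bar>x\<bar> + R)..\<bar>x\<bar> + R}" "{y. ?u' y \<noteq> 0} \<subseteq> {-(\<bar>x\<bar> + R)..\<bar>x\<bar> + R}"
      using out by blast+
    show "integrable lborel ?u'"
      using int0 int[OF lb] by (rule Bochner_Integration.integrable_diff)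
  qed
  moreover have "(LINT y|lborel. ?u' y) = convolution f' e x - convolution f (nderiv 1 e) x"
    unfolding convolution_def using int0 int[OF lb] by (rule Bochner_Integration.integral_diff)
  ultimately have "convolution f' e x - convolution f (nderiv 1 e) x = fm * e x - fp * e x"
    by (simp only:)
  then show ?thesis
    unfolding nderiv_convolution[OF lb e] by (simp add: algebra_simps)
qed

lemma distribution_dirac_combination: "distribution (\<lambda>\<psi>. a * dirac \<psi> + b * distr_deriv dirac \<psi>)"
  unfolding distribution_def
proof (intro conjI ballI allI impI)
  fix \<phi> \<psi> :: "real \<Rightarrow> complex" and c d assume "\<phi> \<in> test_functions" "\<psi> \<in> test_functions"
  then have "((\<lambda>x. c * \<phi> x + d * \<psi> x) has_vector_derivative c * nderiv 1 \<phi> 0 + d * nderiv 1 \<psi> 0) (at 0)"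
    using smooth_has_vector_derivative[of _ 0, OF test_functions_smooth]
    by (auto intro!: has_vector_derivative_add has_vector_derivative_mult_right)
  from nderiv_1[OF this]
  show "a * dirac (\<lambda>x. c * \<phi> x + d * \<psi> x) + b * distr_deriv dirac (\<lambda>x. c * \<phi> x + d * \<psi> x) =
      c * (a * dirac \<phi> + b * distr_deriv dirac \<phi>) + d * (a * dirac \<psi> + b * distr_deriv dirac \<psi>)"
    by (simp add: dirac_def distr_deriv_def algebra_simps)
next
  fix K :: "real set"
  show "\<exists>C N. \<forall>\<psi>\<in>test_functions. {x. \<psi> x \<noteq> 0} \<subseteq> K \<longrightarrow>
      norm (a * dirac \<psi> + b * distr_deriv dirac \<psi>) \<le> C * (\<Sum>p\<le>N. SUP x. norm (nderiv p \<psi> x))"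
  \<comment> \<open>The witnesses, fixed by the final inequality, are |a| + |b| and N = 1 for every
    \<open>K\<close>: the distribution has order at most 1.\<close>
  proof (intro exI ballI impI)
    fix \<psi> :: "real \<Rightarrow> complex" assume \<psi>: "\<psi> \<in> test_functions"
    have sup: "norm (nderiv p \<psi> 0) \<le> (SUP x. norm (nderiv p \<psi> x))" for p
    proof -
      obtain B where "\<And>x. norm (nderiv p \<psi> x) \<le> B"
        using test_functions_bounded[OF nderiv_test_functions[OF \<psi>]] by metis
      then show ?thesis
        by (intro cSUP_upper bdd_aboveI2[of _ _ B]) auto
    qed
    have sup0: "0 \<le> (SUP x. norm (nderiv p \<psi> x))" for p
      using order_trans[OF norm_ge_zero sup] .
    have "norm (a * dirac \<psi> + b * distr_deriv dirac \<psi>)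
        \<le> norm a * norm (nderiv 0 \<psi> 0) + norm b * norm (nderiv 1 \<psi> 0)"
      unfolding dirac_def distr_deriv_def by (rule norm_triangle_le) (simp add: norm_mult)
    also have "\<dots> \<le> (norm a + norm b) * (SUP x. norm (nderiv 0 \<psi> x)) +
        (norm a + norm b) * (SUP x. norm (nderiv 1 \<psi> x))"
      by (intro add_mono mult_mono sup) auto
    also have "\<dots> = (norm a + norm b) * (\<Sum>p\<le>1. SUP x. norm (nderiv p \<psi> x))"
      by (simp add: distrib_left)
    finally show "norm (a * dirac \<psi> + b * distr_deriv dirac \<psi>)
        \<le> (norm a + norm b) * (\<Sum>p\<le>1. SUP x. norm (nderiv p \<psi> x))" .
  qed
qed


section \<open>Limits and association\<close>

text \<open>Near 0, replacing g by m + k sgn and \<psi> by \<psi>(0) costs a multiple of \<eta>,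
  measured by the L1 norm of e. What remains integrates exactly to m \<psi>(0): e has integral 1,
  and the sgn part is odd.\<close>

lemma tendsto_dilated_convolution:
  assumes D: "delta_modelling D" "bounded_profiles D"
    and g: "\<And>x. x \<noteq> 0 \<Longrightarrow> isCont g x" "(g \<longlongrightarrow> gp) (at_right 0)" "(g \<longlongrightarrow> gm) (at_left 0)"
    and \<psi>: "\<psi> \<in> test_functions"
  shows "((\<lambda>\<sigma>. LINT x|lborel. dilated D \<sigma> x * convolution g (dilated D \<sigma>) x * \<psi> x)
    \<longlongrightarrow> (gm + gp) / 2 * \<psi> 0) (at_right 0)"
proof -
  define sg :: "real \<Rightarrow> complex" where "sg t = of_real (sgn t)" for t
  have sg: "locally_bounded sg"
  proof -
    have "sg \<in> borel_measurable borel"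
      unfolding sg_def by measurable
    moreover have "norm (sg x) \<le> 1" for x
      by (simp add: sg_def sgn_if)
    ultimately show ?thesis
      by (auto simp: locally_bounded_def)
  qed
  have lb: "locally_bounded g"
    using g by (rule locally_bounded_jump)
  \<comment> \<open>Chosen so that m + k is the right limit and m - k the left one.\<close>
  define m where "m = (gm + gp) / 2"
  define k where "k = (gp - gm) / 2"
  obtain l L M where lL: "l > 0" "L > 0" "M > 0" and
    prof: "\<forall>\<^sub>F \<sigma> in at_right 0. 0 < \<sigma> \<and> {x. dilated D \<sigma> x \<noteq> 0} \<subseteq> {-(l * \<sigma>)..l * \<sigma>} \<and>
      (LINT x|lborel. norm (dilated D \<sigma> x)) \<le> L \<and> \<sigma> * (LINT x|lborel. (norm (dilated D \<sigma> x))\<^sup>2) \<le> M"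
    by (rule bounded_profiles_dilated[OF D])
  obtain X where X: "X > 0" "\<And>x. norm (\<psi> x) \<le> X"
    using test_functions_bounded[OF \<psi>] by metis
  \<comment> \<open>The outer L bounds the integral of |e|. Inside, L X is the cost of approximating
    g, with X bounding \<psi>, and |m| + |k| L bounds m + k (sgn * e), the factor of \<psi> -
    \<psi>(0).\<close>
  define C where "C = L * (L * X + (norm m + norm k * L))"
  have "C \<ge> 0"
    using lL X by (simp add: C_def)
  have est: "\<forall>\<^sub>F \<sigma> in at_right 0. norm ((LINT x|lborel. dilated D \<sigma> x *
      convolution g (dilated D \<sigma>) x * \<psi> x) - m * \<psi> 0) \<le> C * \<eta>" if "\<eta> > 0" for \<eta>
  proof -
    have mk: "m + k = gp" "m - k = gm"
      by (simp_all add: m_def k_def field_simps)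
    have "\<forall>\<^sub>F t in at_right 0. norm (g t - gp) < \<eta>" "\<forall>\<^sub>F t in at_left 0. norm (g t - gm) < \<eta>"
      using g(2,3) \<open>\<eta> > 0\<close> by (auto simp: tendsto_iff dist_norm)
    then obtain d1 d2 where "d1 > 0" "\<And>t. 0 < t \<Longrightarrow> t < d1 \<Longrightarrow> norm (g t - gp) < \<eta>"
      "d2 < 0" "\<And>t. d2 < t \<Longrightarrow> t < 0 \<Longrightarrow> norm (g t - gm) < \<eta>"
      unfolding eventually_at_right_field eventually_at_left_field by blast
    note d12 = this
    have "isCont \<psi> 0"
      using smooth_has_vector_derivative[OF test_functions_smooth[OF \<psi>], of 0]
      by (auto intro: has_vector_derivative_continuous)
    then obtain d3 where d3: "d3 > 0" "\<And>t. \<bar>t\<bar> < d3 \<Longrightarrow> norm (\<psi> t - \<psi> 0) < \<eta>"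
      using \<open>\<eta> > 0\<close> unfolding continuous_at_eps_delta dist_norm by auto
    define d where "d = min d1 (min (- d2) d3)"
    have d: "d > 0" "\<And>t. \<bar>t\<bar> < d \<Longrightarrow> norm (\<psi> t - \<psi> 0) \<le> \<eta>"
      "\<And>t. t \<noteq> 0 \<Longrightarrow> \<bar>t\<bar> < d \<Longrightarrow> norm (g t - m - k * sg t) \<le> \<eta>"
    proof -
      show "d > 0"
        using d12 d3 by (simp add: d_def)
      show "norm (\<psi> t - \<psi> 0) \<le> \<eta>" if "\<bar>t\<bar> < d" for t
        using d3(2)[of t] that by (simp add: d_def)
      show "norm (g t - m - k * sg t) \<le> \<eta>" if "t \<noteq> 0" "\<bar>t\<bar> < d" for t
      proof (cases "t > 0")
        case True
        then have eq: "g t - m - k * sg t = g t - gp"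
          by (simp add: sg_def flip: mk)
        show ?thesis
          unfolding eq using d12(2)[of t] True that by (simp add: d_def)
      next
        case False
        then have eq: "g t - m - k * sg t = g t - gm"
          using that by (simp add: sg_def flip: mk)
        show ?thesis
          unfolding eq using d12(4)[of t] False that by (simp add: d_def)
      qed
    qed
    \<comment> \<open>If x and x - y both lie within l \<sigma> of 0, then |y| \<le> 2 l \<sigma>;
      this must stay below d.\<close>
    have "d / (2 * l) > 0"
      using d lL by simp
    from prof eventually_at_right_0[OF this] show ?thesis
    proof eventually_elim
      case (elim \<sigma>)
      define e where "e = dilated D \<sigma>"
      have \<sigma>: "\<sigma> > 0" and supp: "{x. e x \<noteq> 0} \<subseteq> {-(l * \<sigma>)..l * \<sigma>}"
        and L: "(LINT x|lborel. norm (e x)) \<le> L" and small: "2 * (l * \<sigma>) < d"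
        using elim lL by (auto simp: e_def field_simps)
      have e: "e \<in> test_functions" "\<And>x. e (- x) = e x" "(LINT x|lborel. e x) = 1"
        using D(1) \<sigma> by (simp_all add: e_def dilated_test_functions dilated_even integral_dilated)
      have inte: "integrable lborel e"
        by (rule test_functions_integrable[OF e(1)])
      have intes: "integrable lborel (\<lambda>y. e (x - y))" for x
        using lborel_integrable_real_affine[OF inte, of "-1" x] by simp
      have Les: "(LINT y|lborel. norm (e (x - y))) = (LINT y|lborel. norm (e y))"
          "(LINT y|lborel. e (x - y)) = 1" for x
        using lborel_integral_real_affine[of "-1" "\<lambda>y. norm (e y)" x]
          lborel_integral_real_affine[of "-1" e x] e(3) by simp_all
      have intc: "integrable lborel (\<lambda>y. h y * e (x - y))" if h: "locally_bounded h" for h x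
      proof -
        obtain B where "\<And>x. norm (e x) \<le> B"
          using test_functions_bounded[OF e(1)] by metis
        then show ?thesis
          using supp \<sigma> lL test_functions_borel[OF e(1)]
          by (intro convolution_integrable[OF h, of _ "l * \<sigma>" B]) auto
      qed
      let ?G = "convolution g e" and ?S = "convolution sg e"
      have near: "norm (?G x - m - k * ?S x) \<le> \<eta> * L" if "\<bar>x\<bar> \<le> l * \<sigma>" for x
      proof -
        have "?G x - m * (LINT y|lborel. e (x - y)) - k * ?S x =
            (LINT y|lborel. g y * e (x - y) - m * e (x - y) - k * (sg y * e (x - y)))"
          unfolding convolution_def using intc[OF lb] intc[OF sg] intes by simp
        also have "\<dots> = (LINT y|lborel. (g y - m - k * sg y) * e (x - y))"
          by (simp add: algebra_simps)
        also have "norm \<dots> \<le> (LINT y|lborel. norm ((g y - m - k * sg y) * e (x - y)))"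
          by (rule integral_norm_bound)
        also have "\<dots> \<le> (LINT y|lborel. \<eta> * norm (e (x - y)))"
        proof (rule integral_mono_AE)
          have "integrable lborel (\<lambda>y. g y * e (x - y) - m * e (x - y) - k * (sg y * e (x - y)))"
            using intc[OF lb] intc[OF sg] intes by simp
          then show "integrable lborel (\<lambda>y. norm ((g y - m - k * sg y) * e (x - y)))"
            by (intro integrable_norm) (simp add: algebra_simps)
          show "integrable lborel (\<lambda>y. \<eta> * norm (e (x - y)))"
            using intes by simp
          \<comment> \<open>The approximation of g by m + k sgn excludes y = 0, where g is
            arbitrary; a single point is a null set.\<close>
          show "AE y in lborel. norm ((g y - m - k * sg y) * e (x - y)) \<le> \<eta> * norm (e (x - y))"
            using AE_lborel_singleton[of 0]
          proof eventually_elim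
            case (elim y)
            show ?case
            proof (cases "e (x - y) = 0")
              case False
              then have "x - y \<in> {-(l * \<sigma>)..l * \<sigma>}"
                using supp by blast
              then have "\<bar>y\<bar> < d"
                using that small by (auto simp: abs_le_iff abs_less_iff)
              then show ?thesis
                using d(3)[OF elim] by (simp add: norm_mult mult_right_mono)
            qed simp
          qed
        qed
        also have "\<dots> \<le> \<eta> * L"
          using L \<open>\<eta> > 0\<close> by (simp add: Les)
        finally show ?thesis
          by (simp add: Les)
      qed
      have S_le: "norm (?S x) \<le> L" for x
      proof -
        have "norm (?S x) \<le> (LINT y|lborel. norm (e (x - y)))"
          unfolding convolution_def
          by (intro Bochner_Integration.integral_norm_bound_integral intc sg integrable_norm intes)
            (simp add: sg_def norm_mult sgn_if)
        then show ?thesis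
          using L by (simp add: Les)
      qed
      have S_odd: "?S (- x) = - ?S x" for x
      proof -
        have "?S (- x) = (LINT y|lborel. sg (- y) * e (- x - - y))"
          unfolding convolution_def
          using lborel_integral_real_affine[of "-1" "\<lambda>y. sg y * e (- x - y)" 0] by simp
        also have "\<dots> = (LINT y|lborel. - (sg y * e (x - y)))"
        proof -
          have "sg (- y) * e (- x - - y) = - (sg y * e (x - y))" for y
            using e(2)[of "x - y"] by (simp add: sg_def sgn_minus)
          then show ?thesis
            by (simp only:)
        qed
        finally show ?thesis
          by (simp add: convolution_def)
      qed
      have eS: "(LINT x|lborel. e x * ?S x) = 0"
        by (rule integral_odd) (simp add: e(2) S_odd)
      have smG: "smooth ?G" and smS: "smooth ?S"
        using smooth_convolution lb sg e(1) by blast+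
      have int1: "integrable lborel (\<lambda>x. e x * ?S x)"
        using e(1) smS by (intro test_functions_integrable test_functions_mult)
      have int2: "integrable lborel (\<lambda>x. e x * ?G x * \<psi> x)"
        using e(1) smG test_functions_smooth[OF \<psi>]
        by (intro test_functions_integrable test_functions_mult)
      \<comment> \<open>The number m \<psi>(0) is written as an integral against e, and the
        vanishing odd term is inserted, so that the error becomes one integral.\<close>
      have "(LINT x|lborel. e x * ?G x * \<psi> x) - m * \<psi> 0 =
          (LINT x|lborel. e x * ?G x * \<psi> x) - m * \<psi> 0 * (LINT x|lborel. e x)
            - k * \<psi> 0 * (LINT x|lborel. e x * ?S x)"
        by (simp add: e(3) eS)
      also have "\<dots> = (LINT x|lborel. e x * ?G x * \<psi> x - m * \<psi> 0 * e x - k * \<psi> 0 * (e x * ?S x))"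
        using inte int1 int2 by simp
      finally have eq: "(LINT x|lborel. e x * ?G x * \<psi> x) - m * \<psi> 0 =
          (LINT x|lborel. e x * ?G x * \<psi> x - m * \<psi> 0 * e x - k * \<psi> 0 * (e x * ?S x))" .
      have "norm ((LINT x|lborel. e x * ?G x * \<psi> x) - m * \<psi> 0) \<le>
          (LINT x|lborel. norm (e x) * (\<eta> * (L * X + (norm m + norm k * L))))"
        unfolding eq
      proof (rule Bochner_Integration.integral_norm_bound_integral)
        show "norm (e x * ?G x * \<psi> x - m * \<psi> 0 * e x - k * \<psi> 0 * (e x * ?S x)) \<le>
            norm (e x) * (\<eta> * (L * X + (norm m + norm k * L)))" for x
        proof (cases "e x = 0")
          case False
          then have x: "x \<in> {-(l * \<sigma>)..l * \<sigma>}"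
            using supp by blast
          then have xl: "\<bar>x\<bar> \<le> l * \<sigma>"
            by (auto simp: abs_le_iff)
          moreover have "l * \<sigma> > 0"
            using lL \<sigma> by simp
          ultimately have "\<bar>x\<bar> < d"
            using small by linarith
          have mk: "norm (m + k * ?S x) \<le> norm m + norm k * L"
            using S_le[of x] by (intro norm_triangle_le add_mono) (auto simp: norm_mult mult_left_mono)
          \<comment> \<open>With S the convolution of sgn, G \<psi> - (m + k S) \<psi>(0) splits
            into the error of G and the error of \<psi>.\<close>
          have "norm ((?G x - m - k * ?S x) * \<psi> x + (m + k * ?S x) * (\<psi> x - \<psi> 0)) \<le>
              \<eta> * L * X + (norm m + norm k * L) * \<eta>"
            unfolding norm_mult[of "_ - _ - _"] norm_mult[of "_ + _"]
            using near[OF xl] X(2)[of x] mk d(2)[OF \<open>\<bar>x\<bar> < d\<close>] \<open>\<eta> > 0\<close> lL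
            by (intro norm_triangle_le add_mono) (auto simp: norm_mult intro!: mult_mono)
          also have "\<dots> = \<eta> * (L * X + (norm m + norm k * L))"
            by (simp add: algebra_simps)
          finally have "norm (e x * ((?G x - m - k * ?S x) * \<psi> x + (m + k * ?S x) * (\<psi> x - \<psi> 0)))
              \<le> norm (e x) * (\<eta> * (L * X + (norm m + norm k * L)))"
            unfolding norm_mult[of "e x"] by (rule mult_left_mono) simp
          moreover have "e x * ((?G x - m - k * ?S x) * \<psi> x + (m + k * ?S x) * (\<psi> x - \<psi> 0)) =
              e x * ?G x * \<psi> x - m * \<psi> 0 * e x - k * \<psi> 0 * (e x * ?S x)"
            by (simp add: algebra_simps)
          ultimately show ?thesis
            by (simp only:)
        qed simp
        show "integrable lborel (\<lambda>x. e x * ?G x * \<psi> x - m * \<psi> 0 * e x - k * \<psi> 0 * (e x * ?S x))"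
          using inte int1 int2 by (intro Bochner_Integration.integrable_diff integrable_mult_right)
        show "integrable lborel (\<lambda>x. norm (e x) * (\<eta> * (L * X + (norm m + norm k * L))))"
          using inte by (intro integrable_mult_left integrable_norm)
      qed
      also have "\<dots> = (LINT x|lborel. norm (e x)) * (\<eta> * (L * X + (norm m + norm k * L)))"
        by (rule integral_mult_left_zero)
      also have "\<dots> \<le> L * (\<eta> * (L * X + (norm m + norm k * L)))"
        using L \<open>\<eta> > 0\<close> lL X by (intro mult_right_mono) auto
      also have "\<dots> = C * \<eta>"
        by (simp add: C_def)
      finally show ?case
        by (simp add: e_def)
    qed
  qed
  show ?thesis
    unfolding tendsto_iff m_def[symmetric] dist_norm
  proof (intro allI impI)
    fix r :: real assume "r > 0"
    define \<eta> where "\<eta> = r / (C + 1)"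
    have \<eta>: "\<eta> > 0" "C * \<eta> < r"
      using \<open>r > 0\<close> \<open>C \<ge> 0\<close> by (auto simp: \<eta>_def field_simps)
    from est[OF \<eta>(1)] show "\<forall>\<^sub>F \<sigma> in at_right 0. norm ((LINT x|lborel. dilated D \<sigma> x *
      convolution g (dilated D \<sigma>) x * \<psi> x) - m * \<psi> 0) < r"
      using \<eta>(2) by (auto elim!: eventually_mono)
  qed
qed

text \<open>Makes \<open>e\<^sup>2\<close> times the identity a test function, hence integrable;
  this is the linear Taylor term in the next limit.\<close>

lemma smooth_of_real: "smooth (of_real :: real \<Rightarrow> complex)"
proof -
  define G :: "nat \<Rightarrow> real \<Rightarrow> complex" where
    "G p x = (if p = 0 then of_real x else if p = 1 then 1 else 0)" for p x
  have "(G p has_vector_derivative G (Suc p) x) (at x)" for p x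
    unfolding G_def by (auto intro!: derivative_eq_intros has_vector_derivative_of_real)
  then have "smooth (G 0)"
    by (rule smoothI_nderiv)
  then show ?thesis
    by (simp add: G_def[abs_def])
qed

text \<open>
  Since \<open>\<integral>|e|\<^sup>2\<close> may grow like \<open>1/\<sigma>\<close> on an interval of length \<open>O(\<sigma>)\<close>, the first-order Taylor term of \<open>\<psi>\<close> is
  not negligible in size; it vanishes because \<open>e\<close> is even.
\<close>

lemma tendsto_dilated_square:
  assumes D: "delta_modelling D" "bounded_profiles D" and \<psi>: "\<psi> \<in> test_functions"
  shows "((\<lambda>\<sigma>. LINT x|lborel. (dilated D \<sigma> x)\<^sup>2 * \<psi> x) \<longlongrightarrow> \<psi> 0) (at_right 0)"
proof -
  obtain l L M where lL: "l > 0" "L > 0" "M > 0" and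
    prof: "\<forall>\<^sub>F \<sigma> in at_right 0. 0 < \<sigma> \<and> {x. dilated D \<sigma> x \<noteq> 0} \<subseteq> {-(l * \<sigma>)..l * \<sigma>} \<and>
      (LINT x|lborel. norm (dilated D \<sigma> x)) \<le> L \<and> \<sigma> * (LINT x|lborel. (norm (dilated D \<sigma> x))\<^sup>2) \<le> M"
    by (rule bounded_profiles_dilated[OF D])
  obtain B where B: "B > 0" "\<And>x. norm (nderiv 2 \<psi> x) \<le> B"
    using test_functions_bounded[OF nderiv_test_functions[OF \<psi>]] by metis
  have "\<forall>\<^sub>F \<sigma> in at_right 0. norm ((LINT x|lborel. (dilated D \<sigma> x)\<^sup>2 * \<psi> x) - \<psi> 0) \<le> B * l\<^sup>2 * M * \<sigma>"
    using prof
  proof eventually_elim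
    case (elim \<sigma>)
    define e where "e = dilated D \<sigma>"
    have \<sigma>: "\<sigma> > 0" and supp: "{x. e x \<noteq> 0} \<subseteq> {-(l * \<sigma>)..l * \<sigma>}"
      and M: "\<sigma> * (LINT x|lborel. (norm (e x))\<^sup>2) \<le> M"
      using elim by (auto simp: e_def)
    have e: "e \<in> test_functions" "\<And>x. e (- x) = e x" "(LINT x|lborel. (e x)\<^sup>2) = 1"
      using D(1) \<sigma> by (simp_all add: e_def dilated_test_functions dilated_even integral_dilated_square)
    have e2: "(\<lambda>x. (e x)\<^sup>2) \<in> test_functions"
      using test_functions_mult[OF e(1) test_functions_smooth[OF e(1)]] by (simp add: power2_eq_square)
    have int: "integrable lborel (\<lambda>x. (e x)\<^sup>2 * h x)" if "smooth h" for h
      using e2 that by (intro test_functions_integrable test_functions_mult)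
    have odd: "(LINT x|lborel. (e x)\<^sup>2 * of_real x) = 0"
      by (rule integral_odd) (simp add: e(2))
    let ?h = "\<lambda>x. \<psi> x - \<psi> 0 - (x - 0) *\<^sub>R nderiv 1 \<psi> 0"
    \<comment> \<open>The integral of \<open>e\<^sup>2\<close> is 1 and its first moment is 0, so
      the whole first-order Taylor polynomial of \<psi> can be subtracted under the
      integral.\<close>
    have "(LINT x|lborel. (e x)\<^sup>2 * \<psi> x) - \<psi> 0 = (LINT x|lborel. (e x)\<^sup>2 * \<psi> x)
        - \<psi> 0 * (LINT x|lborel. (e x)\<^sup>2) - nderiv 1 \<psi> 0 * (LINT x|lborel. (e x)\<^sup>2 * of_real x)"
      by (simp add: e(3) odd)
    also have "\<dots> = (LINT x|lborel. (e x)\<^sup>2 * \<psi> x - \<psi> 0 * (e x)\<^sup>2 - nderiv 1 \<psi> 0 * ((e x)\<^sup>2 * of_real x))"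
      using int[OF smooth_of_real] int[OF test_functions_smooth[OF \<psi>]] test_functions_integrable[OF e2]
      by simp
    also have "norm \<dots> \<le> (LINT x|lborel. (norm (e x))\<^sup>2 * (B * (l * \<sigma>)\<^sup>2))"
    proof (rule Bochner_Integration.integral_norm_bound_integral)
      show "norm ((e x)\<^sup>2 * \<psi> x - \<psi> 0 * (e x)\<^sup>2 - nderiv 1 \<psi> 0 * ((e x)\<^sup>2 * of_real x)) \<le>
          (norm (e x))\<^sup>2 * (B * (l * \<sigma>)\<^sup>2)" for x
      proof (cases "e x = 0")
        case False
        then have x: "x \<in> {-(l * \<sigma>)..l * \<sigma>}"
          using supp by blast
        have "norm (?h x) \<le> B * (x - 0)\<^sup>2"
          by (rule taylor_bound[OF test_functions_smooth[OF \<psi>] B(2)])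
        also have "\<dots> \<le> B * (l * \<sigma>)\<^sup>2"
          using x B(1) by (intro mult_left_mono abs_le_square_iff[THEN iffD1]) (auto simp: abs_le_iff)
        finally have "norm ((e x)\<^sup>2 * ?h x) \<le> (norm (e x))\<^sup>2 * (B * (l * \<sigma>)\<^sup>2)"
          unfolding norm_mult norm_power by (rule mult_left_mono) simp
        moreover have "(e x)\<^sup>2 * ?h x = (e x)\<^sup>2 * \<psi> x - \<psi> 0 * (e x)\<^sup>2 - nderiv 1 \<psi> 0 * ((e x)\<^sup>2 * of_real x)"
          by (simp add: algebra_simps scaleR_conv_of_real)
        ultimately show ?thesis
          by (simp only:)
      qed simp
      show "integrable lborel (\<lambda>x. (norm (e x))\<^sup>2 * (B * (l * \<sigma>)\<^sup>2))"
        using integrable_norm[OF test_functions_integrable[OF e2]] by (simp add: norm_power)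
    qed (use int[OF smooth_of_real] int[OF test_functions_smooth[OF \<psi>]] test_functions_integrable[OF e2]
        in auto)
    \<comment> \<open>Of the two factors \<sigma> in the Taylor remainder, one is absorbed by the
      growth of the squared L2 norm and the other tends to 0.\<close>
    also have "\<dots> = \<sigma> * (LINT x|lborel. (norm (e x))\<^sup>2) * (B * l\<^sup>2 * \<sigma>)"
      by (simp add: power2_eq_square)
    also have "\<dots> \<le> M * (B * l\<^sup>2 * \<sigma>)"
      using M B(1) \<sigma> by (intro mult_right_mono) auto
    finally show ?case
      by (simp add: e_def mult_ac)
  qed
  moreover have "((\<lambda>\<sigma>. B * l\<^sup>2 * M * \<sigma>) \<longlongrightarrow> B * l\<^sup>2 * M * 0) (at_right 0)"
    by (intro tendsto_intros)
  ultimately have "((\<lambda>\<sigma>. (LINT x|lborel. (dilated D \<sigma> x)\<^sup>2 * \<psi> x) - \<psi> 0) \<longlongrightarrow> 0) (at_right 0)"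
    unfolding mult_zero_right by (rule Lim_null_comparison)
  then show ?thesis
    by (simp add: LIM_zero_iff)
qed

lemma tendsto_model_times_deriv:
  assumes D: "delta_modelling D" "bounded_profiles D"
    and f: "\<And>x. x \<noteq> 0 \<Longrightarrow> (f has_vector_derivative f' x) (at x)"
      "(f \<longlongrightarrow> fp) (at_right 0)" "(f \<longlongrightarrow> fm) (at_left 0)"
    and f': "\<And>x. x \<noteq> 0 \<Longrightarrow> isCont f' x" "(f' \<longlongrightarrow> gp) (at_right 0)" "(f' \<longlongrightarrow> gm) (at_left 0)"
    and \<psi>: "\<psi> \<in> test_functions"
  shows "((\<lambda>\<sigma>. LINT x|lborel. convolution f (dilated D \<sigma>) x * nderiv 1 (dilated D \<sigma>) x * \<psi> x)
    \<longlongrightarrow> - ((fp - fm) + (gm + gp) / 2) * \<psi> 0 - (fm + fp) / 2 * nderiv 1 \<psi> 0) (at_right 0)"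
proof -
  have cont: "isCont f x" if "x \<noteq> 0" for x
    using f(1)[OF that] by (rule has_vector_derivative_continuous)
  have lb: "locally_bounded f" and lb': "locally_bounded f'"
    using locally_bounded_jump[OF cont f(2,3)] locally_bounded_jump[OF f'] by auto
  \<comment> \<open>The integration by parts solved for the product. The convolution limit enters
    twice: for f' with \<psi>, and for f with \<psi>' as the test function.\<close>
  let ?I = "\<lambda>\<sigma>. - ((fp - fm) * (LINT x|lborel. (dilated D \<sigma> x)\<^sup>2 * \<psi> x)) -
      (LINT x|lborel. dilated D \<sigma> x * convolution f' (dilated D \<sigma>) x * \<psi> x) -
      (LINT x|lborel. dilated D \<sigma> x * convolution f (dilated D \<sigma>) x * nderiv 1 \<psi> x)"
  have "(?I \<longlongrightarrow> - ((fp - fm) * \<psi> 0) - (gm + gp) / 2 * \<psi> 0 - (fm + fp) / 2 * nderiv 1 \<psi> 0) (at_right 0)"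
    by (intro tendsto_diff tendsto_minus tendsto_mult tendsto_const tendsto_dilated_square[OF D]
        tendsto_dilated_convolution[OF D] cont f f' \<psi> nderiv_test_functions)
  then have lim: "(?I \<longlongrightarrow> - ((fp - fm) + (gm + gp) / 2) * \<psi> 0 - (fm + fp) / 2 * nderiv 1 \<psi> 0) (at_right 0)"
    by (simp add: algebra_simps)
  have "\<forall>\<^sub>F \<sigma> in at_right 0. ?I \<sigma> =
      (LINT x|lborel. convolution f (dilated D \<sigma>) x * nderiv 1 (dilated D \<sigma>) x * \<psi> x)"
    using eventually_at_right_0[OF zero_less_one]
  proof eventually_elim
    case (elim \<sigma>)
    define e where "e = dilated D \<sigma>"
    define F where "F = convolution f e"
    define G where "G = convolution f' e"
    have e: "e \<in> test_functions"
      using D(1) elim by (simp add: e_def dilated_test_functions)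
    have sm: "smooth e" "smooth F" "smooth G" "smooth \<psi>" "smooth (nderiv 1 e)" "smooth (nderiv 1 \<psi>)"
      using e \<psi> lb lb' by (simp_all add: F_def G_def smooth_convolution test_functions_smooth smooth_nderiv)
    have F': "nderiv 1 F x = (fp - fm) * e x + G x" for x
      unfolding F_def G_def by (rule nderiv_convolution_jump[OF f lb' e])
    have diff: "u differentiable at x" if "smooth u" for u and x :: real
      using that by (metis nderiv_0 smooth_def)
    \<comment> \<open>The product rule for e F \<psi>, with F' already split into its jump term and
      G.\<close>
    have w': "nderiv 1 (\<lambda>x. e x * F x * \<psi> x) x = (fp - fm) * ((e x)\<^sup>2 * \<psi> x) + e x * G x * \<psi> x
        + F x * nderiv 1 e x * \<psi> x + e x * F x * nderiv 1 \<psi> x" for x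
      using sm by (simp add: nderiv_1_mult[unfolded One_nat_def] diff smooth_mult F'[unfolded One_nat_def]
          algebra_simps power2_eq_square)
    have int: "integrable lborel (\<lambda>x. (e x)\<^sup>2 * \<psi> x)" "integrable lborel (\<lambda>x. e x * G x * \<psi> x)"
      "integrable lborel (\<lambda>x. F x * nderiv 1 e x * \<psi> x)" "integrable lborel (\<lambda>x. e x * F x * nderiv 1 \<psi> x)"
    proof -
      show "integrable lborel (\<lambda>x. (e x)\<^sup>2 * \<psi> x)"
        unfolding power2_eq_square
        using e sm by (intro test_functions_integrable test_functions_mult)
      show "integrable lborel (\<lambda>x. e x * G x * \<psi> x)"
        using e sm by (intro test_functions_integrable test_functions_mult)
      show "integrable lborel (\<lambda>x. e x * F x * nderiv 1 \<psi> x)"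
        using e sm by (intro test_functions_integrable test_functions_mult)
      have "integrable lborel (\<lambda>x. nderiv 1 e x * F x * \<psi> x)"
        using nderiv_test_functions[OF e] sm by (intro test_functions_integrable test_functions_mult)
      then show "integrable lborel (\<lambda>x. F x * nderiv 1 e x * \<psi> x)"
        by (simp add: mult_ac)
    qed
    have "0 = (LINT x|lborel. nderiv 1 (\<lambda>x. e x * F x * \<psi> x) x)"
      using e sm by (intro integral_nderiv_test_function[symmetric] test_functions_mult)
    also have "\<dots> = (fp - fm) * (LINT x|lborel. (e x)\<^sup>2 * \<psi> x) + (LINT x|lborel. e x * G x * \<psi> x)
        + (LINT x|lborel. F x * nderiv 1 e x * \<psi> x) + (LINT x|lborel. e x * F x * nderiv 1 \<psi> x)"
      unfolding w' using int by simp
    finally show ?case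
      unfolding F_def G_def e_def by (simp add: algebra_simps eq_neg_iff_add_eq_0)
  qed
  with lim show ?thesis
    by (rule Lim_transform_eventually)
qed

theorem theorem1:
  fixes f :: "real \<Rightarrow> complex" and D :: "real \<Rightarrow> real \<Rightarrow> complex" and h0 m0 m1 :: complex
  assumes f: "f \<in> Cd 2"
    and D: "delta_modelling D"
    and D_gen: "delta_rep D \<in> moderate_reps"
    and D_bdd: "bounded_profiles D"
    and h0: "h0 = Lim (at_right 0) f - Lim (at_left 0) f"
    and m0: "m0 = (Lim (at_left 0) f + Lim (at_right 0) f) / 2"
    and m1: "m1 = (Lim (at_left 0) (nderiv 1 f) + Lim (at_right 0) (nderiv 1 f)) / 2"
  shows "associated (gmult (gclass (model_rep D f)) (gdiff (gclass (delta_rep D))))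
           (\<lambda>\<psi>. - (h0 + m1) * dirac \<psi> + m0 * distr_deriv dirac \<psi>)"
proof -
  have diff: "nderiv i f differentiable at x" if "i < 2" "x \<noteq> 0" for i x
    using f that by (simp add: Cd_def)
  have f': "(f has_vector_derivative nderiv 1 f x) (at x)" if "x \<noteq> 0" for x
    using diff[of 0 x] that by (simp add: nderiv_Suc flip: vector_derivative_works)
  \<comment> \<open>Twice differentiability gives continuity of f' off 0, so f' qualifies as a
    function with a jump just as f does.\<close>
  have cont: "isCont f x" "isCont (nderiv 1 f) x" if "x \<noteq> 0" for x
    using f'[OF that] diff[of 1 x] that
    by (auto intro: has_vector_derivative_continuous differentiable_imp_continuous_within)
  \<comment> \<open>\<open>Lim\<close> denotes the actual limit because \<open>Cd\<close> provides
    its existence and one-sided limits on the line are unique.\<close>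
  have lim: "(nderiv i f \<longlongrightarrow> Lim (at_right 0) (nderiv i f)) (at_right 0)"
    "(nderiv i f \<longlongrightarrow> Lim (at_left 0) (nderiv i f)) (at_left 0)" if "i \<le> 2" for i
    using f that unfolding Cd_def by (auto simp: tendsto_Lim)
  have lim0: "(f \<longlongrightarrow> Lim (at_right 0) f) (at_right 0)" "(f \<longlongrightarrow> Lim (at_left 0) f) (at_left 0)"
    using lim[of 0] by simp_all
  have lim1: "(nderiv 1 f \<longlongrightarrow> Lim (at_right 0) (nderiv 1 f)) (at_right 0)"
    "(nderiv 1 f \<longlongrightarrow> Lim (at_left 0) (nderiv 1 f)) (at_left 0)"
    using lim[of 1] by simp_all
  have F: "model_rep D f \<in> moderate_reps"
    using locally_bounded_jump[OF cont(1) lim0] D D_bdd D_gen by (rule model_rep_moderate)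
  have D': "(\<lambda>\<phi>. nderiv 1 (delta_rep D \<phi>)) \<in> moderate_reps"
    by (rule moderate_reps_nderiv[OF D_gen])
  let ?G = "\<lambda>\<phi> x. model_rep D f \<phi> x * nderiv 1 (delta_rep D \<phi>) x"
  have G: "?G \<in> moderate_reps"
    using F D' by (rule moderate_reps_mult)
  have prod: "gmult (gclass (model_rep D f)) (gdiff (gclass (delta_rep D))) = gclass ?G"
    by (simp only: gdiff_gclass[OF D_gen] gmult_gclass[OF F D'])
  \<comment> \<open>The limit holds for every mollifier in \<open>mollifiers 0\<close>, so q = 0
    serves for all \<psi>.\<close>
  have "((\<lambda>\<epsilon>. LINT x|lborel. ?G (scaled \<phi> \<epsilon>) x * \<psi> x) \<longlongrightarrow>
      - (h0 + m1) * dirac \<psi> + m0 * distr_deriv dirac \<psi>) (at_right 0)"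
    if \<psi>: "\<psi> \<in> test_functions" and \<phi>: "\<phi> \<in> mollifiers 0" for \<psi> \<phi>
    using filterlim_compose[OF tendsto_model_times_deriv[OF D D_bdd f' lim0 cont(2) lim1 \<psi>]
        filterlim_supp_radius_scaled[OF \<phi>]]
    by (simp add: model_rep_def delta_rep_def dirac_def distr_deriv_def h0 m0 m1)
  then show ?thesis
    unfolding associated_def prod
    by (intro conjI gclass_in_colombeau_algebra[OF G] distribution_dirac_combination
        bexI[OF _ gclass_self[OF G]] ballI exI[of _ 0])
qed

end
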